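(* Let $(M,\bar g,\bar\nabla)$ be a metric-compatible reference geometry: $M$ is a smooth manifold with metric $\bar g$ and affine connection $\bar\nabla$ on $TM$ with $\bar\nabla\bar g=0$ and local connection coefficients $\bar\Gamma$. Let $P_1$ and $P_2$ be two successive admissible dilation--shear deformations, with $$g_1=P_1^T\bar gP_1,\qquad g_2=P_2^Tg_1P_2 .$$ Let $$\Gamma_1=P_1^{-1}\bar\Gamma P_1+P_1^{-1}dP_1$$ be the natural connection coefficients of the first deformed space. Then the natural connection coefficients of the second deformed space, using the first deformed space (with metric $g_1$ and the connection with coefficients $\Gamma_1$) as reference, are $$\Gamma_2=P_2^{-1}\Gamma_1P_2+P_2^{-1}dP_2 .$$ Equivalently, relative to the original reference, the total deformation field is $P_{\rm tot}=P_1P_2$ (so that $g_2=P_{\rm tot}^T\bar gP_{\rm tot}$), with natural connection coefficients $$\Gamma_{\rm tot}=\Lambda_{\rm tot}=(P_1P_2)^{-1}\bar\Gamma(P_1P_2)+(P_1P_2)^{-1}d(P_1P_2),$$ and the two expressions agree: $$\Gamma_{\rm tot}=P_2^{-1}\Gamma_1P_2+P_2^{-1}dP_2 .$$ If the reference comparison is metric-compatible, then every stage remains metric-compatible with its induced metric; that is, $\nabla^{(1)}g_1=0$ and $\nabla^{(2)}g_2=0$, where $\nabla^{(1)}$ and $\nabla^{(2)}$ are the natural covariant derivatives with coefficients $\Gamma_1$ and $\Gamma_2$.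
   Context: $M$ is a smooth $n$-dimensional manifold; metrics are Riemannian or pseudo-Riemannian. A deformation field $P$ is a smooth, pointwise invertible $(1,1)$-tensor field, i.e. a smooth bundle automorphism of $TM$ covering the identity. When a reference metric $h$ is positive-definite, $P$ is admissible over $(M,h)$ if it is $h$-self-adjoint, $h(PX,Y)=h(X,PY)$ for all $X,Y$, and positive-definite. In indefinite signature no further explicit pointwise condition beyond invertibility is specified: the class of admissible fields is part of the given data. "Successive" means that $P_1$ is a deformation of the reference $(M,\bar g)$ and $P_2$ is a deformation of the resulting space $(M,g_1)$ taken as reference. The notation $P^ThP$ denotes the bilinear form $(U,V)\mapsto h(PU,PV)$. In this statement, calling $P_{\rm tot}=P_1P_2$ the total deformation field means that it is the field that represents $g_2$ and its natural connection relative to the original reference; it is not asserted that $P_1P_2$ is $\bar g$-self-adjoint. Natural connection: given a reference metric $h$ with affine connection $D$ and a deformation field $P$, the natural covariant derivative of the deformed space is $\nabla_XV:=P^{-1}D_X(PV)$; its local connection coefficients are the natural connection coefficients. The symbol $\Lambda$ (total natural dilation--shear compensation) is by definition another name for the natural connection coefficients $\Gamma$. Local notation: over an open set, fix a local frame of $TM$ for each of the three descriptions (original reference, first deformed space, second deformed space); these frames may be taken equal. Vector fields are columns of components; $P_1$ is the matrix of the field from the first-deformed frame to the reference frame, $P_2$ the matrix from the second-deformed frame to the first-deformed frame, $dP_i$ is the entrywise exterior derivative, and connection coefficients are matrices of one-forms, so that in components $\bar\nabla V=dV+\bar\Gamma V$, $\nabla^{(i)}V=dV+\Gamma_iV$.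 *)

theory Defs
  imports "HOL-Analysis.Analysis"
begin

section \<open>Smooth manifolds\<close>

text \<open>\<open>Ck_on k f S\<close> is meant for open \<open>S\<close> and a finite-dimensional domain; there, continuity of all
  directional derivatives up to order \<open>k\<close> is the usual notion of class \<open>C\<^sup>k\<close>.\<close>

primrec Ck_on :: "nat \<Rightarrow> ('b::real_normed_vector \<Rightarrow> 'c::real_normed_vector) \<Rightarrow> 'b set \<Rightarrow> bool" where
  "Ck_on 0 f S \<longleftrightarrow> continuous_on S f"
| "Ck_on (Suc k) f S \<longleftrightarrow>
     f differentiable_on S \<and> (\<forall>v. Ck_on k (\<lambda>x. frechet_derivative f (at x) v) S)"

definition smooth_on :: "'b::real_normed_vector set \<Rightarrow> ('b \<Rightarrow> 'c::real_normed_vector) \<Rightarrow> bool" where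
  "smooth_on S f \<longleftrightarrow> (\<forall>k. Ck_on k f S)"

text \<open>A chart is its domain together with its coordinate map, whose values outside the domain are
  irrelevant.\<close>

type_synonym ('a, 'n) chart = "'a set \<times> ('a \<Rightarrow> real^'n)"

definition chart_inv :: "('a, 'n::finite) chart \<Rightarrow> real^'n \<Rightarrow> 'a" where
  "chart_inv c = inv_into (fst c) (snd c)"

definition smooth_manifold :: "'a topology \<Rightarrow> ('a, 'n::finite) chart set \<Rightarrow> bool" where
  "smooth_manifold M A \<longleftrightarrow>
     Hausdorff_space M \<and> second_countable M \<and>
     (\<Union>c\<in>A. fst c) = topspace M \<and>
     (\<forall>c\<in>A. openin M (fst c) \<and> open (snd c ` fst c) \<and>
        homeomorphic_map (subtopology M (fst c)) (top_of_set (snd c ` fst c)) (snd c)) \<and>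
     (\<forall>c\<in>A. \<forall>d\<in>A. smooth_on (snd c ` (fst c \<inter> fst d)) (snd d \<circ> chart_inv c))"

definition smooth_function ::
  "'a topology \<Rightarrow> ('a, 'n::finite) chart set \<Rightarrow> 'a set \<Rightarrow> ('a \<Rightarrow> real) \<Rightarrow> bool" where
  "smooth_function M A U f \<longleftrightarrow>
     openin M U \<and> (\<forall>c\<in>A. smooth_on (snd c ` (U \<inter> fst c)) (f \<circ> chart_inv c))"


section \<open>Tangent vectors and vector fields\<close>

text \<open>A tangent vector is the family of its component columns in the charts around its base point;
  any two of them are related by the Jacobian of the transition map. In charts that do not
  contain the base point, or do not belong to the atlas, the entry is \<open>0\<close>.\<close>

datatype ('a, 'n::finite) tvec = TVec (component: "('a, 'n) chart \<Rightarrow> real^'n")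

instantiation tvec :: (type, finite) real_vector
begin

definition "0 = TVec (\<lambda>c. 0)"
definition "v + w = TVec (\<lambda>c. component v c + component w c)"
definition "- v = TVec (\<lambda>c. - component v c)"
definition "v - w = TVec (\<lambda>c. component v c - component w c)"
definition "r *\<^sub>R v = TVec (\<lambda>c. r *\<^sub>R component v c)"

instance
  by standard
    (auto simp: zero_tvec_def plus_tvec_def uminus_tvec_def minus_tvec_def scaleR_tvec_def
       algebra_simps)

end

definition tangent_space :: "('a, 'n::finite) chart set \<Rightarrow> 'a \<Rightarrow> ('a, 'n) tvec set" where
  "tangent_space A p =
     {v. (\<forall>c. c \<notin> A \<or> p \<notin> fst c \<longrightarrow> component v c = 0) \<and>
         (\<forall>c\<in>A. \<forall>d\<in>A. p \<in> fst c \<longrightarrow> p \<in> fst d \<longrightarrow>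
            component v d =
              frechet_derivative (snd d \<circ> chart_inv c) (at (snd c p)) (component v c))}"

definition smooth_field ::
  "'a topology \<Rightarrow> ('a, 'n::finite) chart set \<Rightarrow> 'a set \<Rightarrow> ('a \<Rightarrow> ('a, 'n) tvec) \<Rightarrow> bool" where
  "smooth_field M A U V \<longleftrightarrow>
     openin M U \<and> (\<forall>p\<in>U. V p \<in> tangent_space A p) \<and>
     (\<forall>c\<in>A. smooth_on (snd c ` (U \<inter> fst c)) (\<lambda>x. component (V (chart_inv c x)) c))"

text \<open>\<open>d f\<close> at \<open>p\<close> on a vector \<open>v\<close> tangent at \<open>p\<close>. By the transformation rule for components the
  value does not depend on the chart.\<close>

definition differential ::
  "('a, 'n::finite) chart set \<Rightarrow> ('a \<Rightarrow> real) \<Rightarrow> 'a \<Rightarrow> ('a, 'n) tvec \<Rightarrow> real" where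
  "differential A f p v =
     (let c = (SOME c. c \<in> A \<and> p \<in> fst c)
      in frechet_derivative (f \<circ> chart_inv c) (at (snd c p)) (component v c))"


section \<open>Metrics, deformation fields, connections\<close>

type_synonym ('a, 'n) bilinear_field = "'a \<Rightarrow> ('a, 'n) tvec \<Rightarrow> ('a, 'n) tvec \<Rightarrow> real"
type_synonym ('a, 'n) endo_field = "'a \<Rightarrow> ('a, 'n) tvec \<Rightarrow> ('a, 'n) tvec"

text \<open>In all of these, only the values on vectors of \<open>tangent_space A p\<close> matter. A tensor field is
  smooth if it sends smooth local vector fields to smooth local functions or vector fields.\<close>

definition negative_index ::
  "('a, 'n::finite) chart set \<Rightarrow> ('a, 'n) bilinear_field \<Rightarrow> 'a \<Rightarrow> nat" where
  "negative_index A g p =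
     Max {dim S | S. subspace S \<and> S \<subseteq> tangent_space A p \<and> (\<forall>v\<in>S. v \<noteq> 0 \<longrightarrow> g p v v < 0)}"

text \<open>Riemannian metrics are the case of negative index \<open>0\<close>.\<close>

definition pseudo_riemannian_metric ::
  "'a topology \<Rightarrow> ('a, 'n::finite) chart set \<Rightarrow> ('a, 'n) bilinear_field \<Rightarrow> bool" where
  "pseudo_riemannian_metric M A g \<longleftrightarrow>
     (\<forall>p\<in>topspace M.
        (\<forall>u\<in>tangent_space A p. \<forall>v\<in>tangent_space A p. \<forall>w\<in>tangent_space A p. \<forall>r.
           g p (r *\<^sub>R u + v) w = r * g p u w + g p v w) \<and>
        (\<forall>u\<in>tangent_space A p. \<forall>v\<in>tangent_space A p. g p u v = g p v u) \<and>
        (\<forall>u\<in>tangent_space A p. (\<forall>v\<in>tangent_space A p. g p u v = 0) \<longrightarrow> u = 0)) \<and>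
     (\<forall>U V W. smooth_field M A U V \<longrightarrow> smooth_field M A U W \<longrightarrow>
        smooth_function M A U (\<lambda>p. g p (V p) (W p))) \<and>
     (\<exists>k. \<forall>p\<in>topspace M. negative_index A g p = k)"

definition positive_definite_metric ::
  "'a topology \<Rightarrow> ('a, 'n::finite) chart set \<Rightarrow> ('a, 'n) bilinear_field \<Rightarrow> bool" where
  "positive_definite_metric M A g \<longleftrightarrow>
     (\<forall>p\<in>topspace M. \<forall>v\<in>tangent_space A p. v \<noteq> 0 \<longrightarrow> g p v v > 0)"

definition deformation_field ::
  "'a topology \<Rightarrow> ('a, 'n::finite) chart set \<Rightarrow> ('a, 'n) endo_field \<Rightarrow> bool" where
  "deformation_field M A P \<longleftrightarrow>
     (\<forall>p\<in>topspace M.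
        (\<forall>u\<in>tangent_space A p. \<forall>v\<in>tangent_space A p. \<forall>r. P p (r *\<^sub>R u + v) = r *\<^sub>R P p u + P p v) \<and>
        bij_betw (P p) (tangent_space A p) (tangent_space A p)) \<and>
     (\<forall>U V. smooth_field M A U V \<longrightarrow> smooth_field M A U (\<lambda>p. P p (V p)))"

text \<open>\<open>Adm h\<close> is the given class of admissible fields for a reference metric \<open>h\<close> that is not
  positive-definite; it plays no role for positive-definite \<open>h\<close>.\<close>

definition admissible ::
  "'a topology \<Rightarrow> ('a, 'n::finite) chart set \<Rightarrow>
   (('a, 'n) bilinear_field \<Rightarrow> ('a, 'n) endo_field set) \<Rightarrow>
   ('a, 'n) bilinear_field \<Rightarrow> ('a, 'n) endo_field \<Rightarrow> bool" where
  "admissible M A Adm h P \<longleftrightarrow>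
     deformation_field M A P \<and>
     (if positive_definite_metric M A h
      then (\<forall>p\<in>topspace M. \<forall>u\<in>tangent_space A p. \<forall>v\<in>tangent_space A p.
              h p (P p u) v = h p u (P p v)) \<and>
           (\<forall>p\<in>topspace M. \<forall>v\<in>tangent_space A p. v \<noteq> 0 \<longrightarrow> h p (P p v) v > 0)
      else P \<in> Adm h)"

text \<open>The bilinear form \<open>P\<^sup>T h P\<close>.\<close>

definition deformed_metric ::
  "('a, 'n::finite) endo_field \<Rightarrow> ('a, 'n) bilinear_field \<Rightarrow> ('a, 'n) bilinear_field" where
  "deformed_metric P h = (\<lambda>p u v. h p (P p u) (P p v))"

text \<open>\<open>D p v V\<close> is the derivative at \<open>p\<close>, in the direction \<open>v\<close>, of a vector field \<open>V\<close> that is smooth on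
  some open neighbourhood of \<open>p\<close>; so \<open>D\<close> acts on local sections of the tangent bundle, compatibly
  with restriction.\<close>

type_synonym ('a, 'n) cov_deriv = "'a \<Rightarrow> ('a, 'n) tvec \<Rightarrow> ('a \<Rightarrow> ('a, 'n) tvec) \<Rightarrow> ('a, 'n) tvec"

definition affine_connection ::
  "'a topology \<Rightarrow> ('a, 'n::finite) chart set \<Rightarrow> ('a, 'n) cov_deriv \<Rightarrow> bool" where
  "affine_connection M A D \<longleftrightarrow>
     (\<forall>U V W. smooth_field M A U V \<longrightarrow> smooth_field M A U W \<longrightarrow>
        smooth_field M A U (\<lambda>p. D p (W p) V) \<and>
        (\<forall>p\<in>U. \<forall>v\<in>tangent_space A p.
           D p v V \<in> tangent_space A p \<and>
           ((\<forall>q\<in>U. V q = W q) \<longrightarrow> D p v V = D p v W) \<and>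
           D p v (\<lambda>q. V q + W q) = D p v V + D p v W \<and>
           (\<forall>f. smooth_function M A U f \<longrightarrow>
              D p v (\<lambda>q. f q *\<^sub>R V q) = differential A f p v *\<^sub>R V p + f p *\<^sub>R D p v V) \<and>
           (\<forall>w\<in>tangent_space A p. \<forall>r. D p (r *\<^sub>R v + w) V = r *\<^sub>R D p v V + D p w V)))"

text \<open>\<open>(\<nabla>\<^sub>v g)(V, W)\<close>\<close>

definition metric_derivative ::
  "('a, 'n::finite) chart set \<Rightarrow> ('a, 'n) cov_deriv \<Rightarrow> ('a, 'n) bilinear_field \<Rightarrow>
   'a \<Rightarrow> ('a, 'n) tvec \<Rightarrow> ('a \<Rightarrow> ('a, 'n) tvec) \<Rightarrow> ('a \<Rightarrow> ('a, 'n) tvec) \<Rightarrow> real" where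
  "metric_derivative A D g p v V W =
     differential A (\<lambda>q. g q (V q) (W q)) p v - g p (D p v V) (W p) - g p (V p) (D p v W)"

definition metric_compatible ::
  "'a topology \<Rightarrow> ('a, 'n::finite) chart set \<Rightarrow> ('a, 'n) bilinear_field \<Rightarrow> ('a, 'n) cov_deriv \<Rightarrow> bool" where
  "metric_compatible M A g D \<longleftrightarrow>
     (\<forall>U V W. smooth_field M A U V \<longrightarrow> smooth_field M A U W \<longrightarrow>
        (\<forall>p\<in>U. \<forall>v\<in>tangent_space A p. metric_derivative A D g p v V W = 0))"

definition metric_compatible_geometry ::
  "'a topology \<Rightarrow> ('a, 'n::finite) chart set \<Rightarrow> ('a, 'n) bilinear_field \<Rightarrow> ('a, 'n) cov_deriv \<Rightarrow> bool" where
  "metric_compatible_geometry M A g D \<longleftrightarrow>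
     smooth_manifold M A \<and> pseudo_riemannian_metric M A g \<and> affine_connection M A D \<and>
     metric_compatible M A g D"

text \<open>\<open>\<nabla>\<^sub>v V = P\<inverse> D\<^sub>v (P V)\<close>\<close>

definition natural_connection ::
  "('a, 'n::finite) chart set \<Rightarrow> ('a, 'n) endo_field \<Rightarrow> ('a, 'n) cov_deriv \<Rightarrow> ('a, 'n) cov_deriv" where
  "natural_connection A P D =
     (\<lambda>p v V. inv_into (tangent_space A p) (P p) (D p v (\<lambda>q. P q (V q))))"


section \<open>Local frames and matrices\<close>

type_synonym ('a, 'n) frame = "'n \<Rightarrow> 'a \<Rightarrow> ('a, 'n) tvec"

definition local_frame ::
  "'a topology \<Rightarrow> ('a, 'n::finite) chart set \<Rightarrow> 'a set \<Rightarrow> ('a, 'n) frame \<Rightarrow> bool" where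
  "local_frame M A U E \<longleftrightarrow>
     openin M U \<and> (\<forall>i. smooth_field M A U (E i)) \<and>
     (\<forall>p\<in>U. inj (\<lambda>i. E i p) \<and> independent (range (\<lambda>i. E i p)) \<and>
        span (range (\<lambda>i. E i p)) = tangent_space A p)"

definition frame_column :: "('a, 'n::finite) frame \<Rightarrow> 'a \<Rightarrow> ('a, 'n) tvec \<Rightarrow> real^'n" where
  "frame_column E p v = (\<chi> i. representation (range (\<lambda>j. E j p)) v (E i p))"

text \<open>The matrix of \<open>P\<close> from the frame \<open>F\<close> to the frame \<open>E\<close>: \<open>P F\<^sub>j = \<Sum>\<^sub>i m\<^sub>i\<^sub>j E\<^sub>i\<close>.\<close>

definition field_matrix ::
  "('a, 'n::finite) endo_field \<Rightarrow> ('a, 'n) frame \<Rightarrow> ('a, 'n) frame \<Rightarrow> 'a \<Rightarrow> real^'n^'n" where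
  "field_matrix P F E p = (\<chi> i j. frame_column E p (P p (F j p)) $ i)"

text \<open>A matrix of one-forms is a matrix-valued function of a base point and a vector tangent there.\<close>

definition matrix_differential ::
  "('a, 'n::finite) chart set \<Rightarrow> ('a \<Rightarrow> real^'n^'n) \<Rightarrow> 'a \<Rightarrow> ('a, 'n) tvec \<Rightarrow> real^'n^'n" where
  "matrix_differential A m p v = (\<chi> i j. differential A (\<lambda>q. m q $ i $ j) p v)"

text \<open>\<open>\<nabla> E\<^sub>j = \<Sum>\<^sub>i \<Gamma>\<^sub>i\<^sub>j E\<^sub>i\<close>. By additivity and the Leibniz rule, this says that \<open>\<nabla> V = d V + \<Gamma> V\<close> for the
  columns of components in the frame \<open>E\<close>.\<close>

definition connection_coefficients ::
  "('a, 'n::finite) cov_deriv \<Rightarrow> ('a, 'n) frame \<Rightarrow> 'a \<Rightarrow> ('a, 'n) tvec \<Rightarrow> real^'n^'n" where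
  "connection_coefficients D E p v = (\<chi> i j. frame_column E p (D p v (E j)) $ i)"

end

theory Submission
  imports Defs
begin

text \<open>Both deformations are bundle automorphisms, so \<open>(P\<^sub>1 P\<^sub>2)\<inverse> D (P\<^sub>1 P\<^sub>2 V) = P\<^sub>2\<inverse> (P\<^sub>1\<inverse> D (P\<^sub>1 (P\<^sub>2 V)))\<close>: deforming
  twice is deforming once by the product, and everything reduces to a single deformation \<open>P\<close>. The
  natural connection is conjugate to the reference connection under \<open>P\<close>, which carries \<open>P\<^sup>T h P\<close> to \<open>h\<close>;
  hence compatibility is inherited, and expanding \<open>P F\<^sub>j\<close> in the reference frame gives \<open>m \<Gamma>' = \<Gamma> m + d m\<close>
  by the Leibniz rule. The analytic input is that \<open>P\<inverse>\<close> and the components in a frame are again smooth,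
  both by Cramer's rule.\<close>

section \<open>Smooth functions between open sets\<close>

text \<open>A deformation field is known to be pointwise bijective, linear on each
  \<open>tangent_space A p\<close> and smooth in the forward direction only. Two difficulties shape
  the work. The type \<open>tvec\<close> is a real vector space without finite dimension or
  topology, so matrices, determinants and dimensions become available only after passing to
  \<open>real^'n\<close> in a chart; \<open>chart_lift\<close> is that passage. And local fields are
  total functions with arbitrary values outside \<open>U\<close>, so an identity such as
  \<open>P (f V) = f (P V)\<close> holds on \<open>U\<close> only: under a connection it is used
  through locality, under \<open>differential\<close> through agreement on an open set. The second
  stage takes the first deformed space as its reference, so the whole structure of a
  metric-compatible geometry has to be reproduced, including the constant signature; that holds
  because \<open>P p\<close> carries negative definite subspaces to negative definite ones of the
  same dimension. \<open>Ck_on\<close> differentiates in one fixed direction at a time, so its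
  closure properties are inductions on the order.\<close>

lemma Ck_on_Suc_has_derivative:
  assumes "Ck_on (Suc k) f S" "open S" "x \<in> S"
  shows "(f has_derivative frechet_derivative f (at x)) (at x)"
proof -
  have "f differentiable at x within S"
    using assms(1,3) by (simp add: differentiable_on_def)
  then show ?thesis
    unfolding at_within_open[OF assms(3,2)] by (rule frechet_derivative_works[THEN iffD1])
qed

lemma Ck_on_Suc_derivative:
  "Ck_on (Suc k) f S \<Longrightarrow> Ck_on k (\<lambda>x. frechet_derivative f (at x) v) S"
  by simp

text \<open>Agreement on an open set is agreement near each of its points, so the derivatives agree
  there too and the induction passes to them. Chart expressions need this: they are total functions,
  but carry meaning on the chart image only.\<close>

lemma Ck_on_cong:
  assumes "open S" "\<And>x. x \<in> S \<Longrightarrow> f x = g x" "Ck_on k f S"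
  shows "Ck_on k g S"
  using assms(2,3)
proof (induction k arbitrary: f g)
  case 0
  then show ?case by (metis Ck_on.simps(1) continuous_on_cong)
next
  case (Suc k)
  have f: "f differentiable at x" if "x \<in> S" for x
    using Ck_on_Suc_has_derivative[OF Suc.prems(2) assms(1) that] by (rule differentiableI)
  have "g differentiable_on S"
    unfolding differentiable_on_def
    using f Suc.prems(1) assms(1)
    by (metis at_within_open differentiable_def has_derivative_transform_within_open)
  moreover have "frechet_derivative f (at x) = frechet_derivative g (at x)" if "x \<in> S" for x
    using frechet_derivative_transform_within_open[OF f[OF that] assms(1) that Suc.prems(1)] .
  then have "Ck_on k (\<lambda>x. frechet_derivative g (at x) v) S" for v
    using Suc.IH[of "\<lambda>x. frechet_derivative f (at x) v" "\<lambda>x. frechet_derivative g (at x) v"]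
      Suc.prems(2) by simp
  ultimately show ?case by simp
qed

text \<open>By uniqueness of derivatives, any explicit derivative may stand in for the chosen
  \<open>frechet_derivative\<close>. In this form the sum, product, reciprocal and chain rules can
  be plugged in directly.\<close>

lemma Ck_on_SucI:
  assumes "open S" "\<And>x. x \<in> S \<Longrightarrow> (f has_derivative f' x) (at x)"
    and "\<And>v. Ck_on k (\<lambda>x. f' x v) S"
  shows "Ck_on (Suc k) f S"
proof -
  have "Ck_on k (\<lambda>x. frechet_derivative f (at x) v) S" for v
    using assms(3) by (rule Ck_on_cong[OF assms(1), rotated]) (simp add: frechet_derivative_at[OF assms(2), symmetric])
  moreover have "f differentiable_on S"
    unfolding differentiable_on_def using at_within_open[OF _ assms(1)] differentiableI[OF assms(2)] by metis
  ultimately show ?thesis by simp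
qed

lemma Ck_on_subset:
  assumes "Ck_on k f S" "T \<subseteq> S"
  shows "Ck_on k f T"
  using assms
  by (induction k arbitrary: f)
    (simp_all, blast intro: continuous_on_subset, blast intro: differentiable_on_subset)

lemma Ck_on_SucD: "Ck_on (Suc k) f S \<Longrightarrow> Ck_on k f S"
proof (induction k arbitrary: f)
  case (Suc k)
  have f: "f differentiable_on S" and f': "Ck_on (Suc k) (\<lambda>x. frechet_derivative f (at x) v) S" for v
    using Suc.prems unfolding Ck_on.simps(2)[of "Suc k"] by blast+
  show ?case
    unfolding Ck_on.simps(2)[of k] using f Suc.IH[OF f'] by blast
qed (simp add: differentiable_imp_continuous_on)

lemma Ck_on_const: "Ck_on k (\<lambda>x. c) S"
  by (induction k arbitrary: c) auto

lemma Ck_on_bounded_linear: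
  assumes "bounded_linear L" "open S" "Ck_on k f S"
  shows "Ck_on k (\<lambda>x. L (f x)) S"
  using assms(3)
proof (induction k arbitrary: f)
  case 0
  then show ?case by (simp add: assms(1) bounded_linear.continuous_on)
next
  case (Suc k)
  show ?case
    by (rule Ck_on_SucI[OF assms(2)
          bounded_linear.has_derivative[OF assms(1) Ck_on_Suc_has_derivative[OF Suc.prems assms(2)]]])
      (assumption | rule Suc.IH[OF Ck_on_Suc_derivative[OF Suc.prems]])+
qed

lemma Ck_on_add:
  assumes "open S" "Ck_on k f S" "Ck_on k g S"
  shows "Ck_on k (\<lambda>x. f x + g x) S"
  using assms(2,3)
proof (induction k arbitrary: f g)
  case 0
  then show ?case by (simp add: continuous_on_add)
next
  case (Suc k)
  show ?case
    by (rule Ck_on_SucI[OF assms(1) has_derivative_add[OF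
          Ck_on_Suc_has_derivative[OF Suc.prems(1) assms(1)]
          Ck_on_Suc_has_derivative[OF Suc.prems(2) assms(1)]]])
      (assumption | rule Suc.IH[OF Ck_on_Suc_derivative[OF Suc.prems(1)] Ck_on_Suc_derivative[OF Suc.prems(2)]])+
qed

lemma Ck_on_sum:
  assumes "open S" "\<And>i. i \<in> I \<Longrightarrow> Ck_on k (f i) S"
  shows "Ck_on k (\<lambda>x. \<Sum>i\<in>I. f i x) S"
  using assms(2)
  by (induction I rule: infinite_finite_induct) (simp_all add: Ck_on_const Ck_on_add assms(1))

lemma Ck_on_scaleR:
  fixes f :: "'b::real_normed_vector \<Rightarrow> real"
  assumes "open S" "Ck_on k f S" "Ck_on k g S"
  shows "Ck_on k (\<lambda>x. f x *\<^sub>R g x) S"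
  using assms(2,3)
proof (induction k arbitrary: f g)
  case 0
  then show ?case by (simp add: continuous_on_scaleR)
next
  case (Suc k)
  show ?case
    by (rule Ck_on_SucI[OF assms(1) has_derivative_scaleR[OF
          Ck_on_Suc_has_derivative[OF Suc.prems(1) assms(1)]
          Ck_on_Suc_has_derivative[OF Suc.prems(2) assms(1)]]])
      (assumption | rule Ck_on_add[OF assms(1)
          Suc.IH[OF Ck_on_SucD[OF Suc.prems(1)] Ck_on_Suc_derivative[OF Suc.prems(2)]]
          Suc.IH[OF Ck_on_Suc_derivative[OF Suc.prems(1)] Ck_on_SucD[OF Suc.prems(2)]]])+
qed

lemma Ck_on_mult:
  fixes f g :: "'b::real_normed_vector \<Rightarrow> real"
  assumes "open S" "Ck_on k f S" "Ck_on k g S"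
  shows "Ck_on k (\<lambda>x. f x * g x) S"
  using Ck_on_scaleR[OF assms] by simp

lemma Ck_on_prod:
  fixes f :: "'i \<Rightarrow> 'b::real_normed_vector \<Rightarrow> real"
  assumes "open S" "\<And>i. i \<in> I \<Longrightarrow> Ck_on k (f i) S"
  shows "Ck_on k (\<lambda>x. \<Prod>i\<in>I. f i x) S"
  using assms(2)
  by (induction I rule: infinite_finite_induct) (simp_all add: Ck_on_const Ck_on_mult assms(1))

text \<open>The derivative of the reciprocal contains the reciprocal again, but only its class of
  order \<open>k\<close> is asked for, and the induction hypothesis provides that.\<close>

lemma Ck_on_inverse:
  fixes f :: "'b::real_normed_vector \<Rightarrow> real"
  assumes "open S" "\<And>x. x \<in> S \<Longrightarrow> f x \<noteq> 0" "Ck_on k f S"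
  shows "Ck_on k (\<lambda>x. inverse (f x)) S"
  using assms(3)
proof (induction k)
  case 0
  then show ?case using assms(2) by (simp add: continuous_on_inverse)
next
  case (Suc k)
  have IH: "Ck_on k (\<lambda>x. inverse (f x)) S"
    by (rule Suc.IH[OF Ck_on_SucD[OF Suc.prems]])
  have f': "Ck_on k (\<lambda>x. frechet_derivative f (at x) v) S" for v
    by (rule Ck_on_Suc_derivative[OF Suc.prems])
  show ?case
  proof (rule Ck_on_SucI[OF assms(1)
          Deriv.has_derivative_inverse[OF assms(2) Ck_on_Suc_has_derivative[OF Suc.prems assms(1)]]])
    fix v
    \<comment> \<open>The sign is written as a constant factor, so that closure under products
      suffices.\<close>
    have "Ck_on k (\<lambda>x. (- 1) * (inverse (f x) * frechet_derivative f (at x) v * inverse (f x))) S"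
      by (intro Ck_on_mult Ck_on_const assms(1) IH f')
    then show "Ck_on k (\<lambda>x. - (inverse (f x) * frechet_derivative f (at x) v * inverse (f x))) S"
      by simp
  qed
qed

section \<open>Smoothness through coordinates: composition and linear systems\<close>

lemma linear_basis_expansion:
  fixes L :: "real^'n \<Rightarrow> 'b::real_vector"
  assumes "linear L"
  shows "L z = (\<Sum>i\<in>UNIV. (z $ i) *\<^sub>R L (axis i 1))"
  using linear_sum[OF assms, of "\<lambda>i. (z $ i) *\<^sub>R axis i 1" UNIV] linear_scale[OF assms]
    basis_expansion[of z] by (simp add: scalar_mult_eq_scaleR)

lemma Ck_on_vec:
  fixes f :: "'b::real_normed_vector \<Rightarrow> real^'n"
  assumes "open S"
  shows "Ck_on k f S \<longleftrightarrow> (\<forall>i. Ck_on k (\<lambda>x. f x $ i) S)"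
proof
  assume "\<forall>i. Ck_on k (\<lambda>x. f x $ i) S"
  then have "Ck_on k (\<lambda>x. \<Sum>i\<in>UNIV. (f x $ i) *\<^sub>R axis i (1::real)) S"
    by (intro Ck_on_sum Ck_on_scaleR Ck_on_const assms) auto
  moreover have "(\<Sum>i\<in>UNIV. (f x $ i) *\<^sub>R axis i (1::real)) = f x" for x
    using basis_expansion[of "f x"] by (simp add: scalar_mult_eq_scaleR)
  ultimately show "Ck_on k f S" by simp
qed (auto intro: Ck_on_bounded_linear[OF bounded_linear_vec_nth assms])

text \<open>In the chain rule the direction in which \<open>g\<close> is differentiated varies with
  the point, whereas \<open>Ck_on\<close> fixes it. Expanding that direction in the standard basis
  turns the derivative into a finite sum of products: components of the derivative of
  \<open>f\<close>, times derivatives of \<open>g\<close> in fixed directions, composed with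
  \<open>f\<close>.\<close>

lemma Ck_on_compose:
  fixes f :: "'b::real_normed_vector \<Rightarrow> real^'n"
  assumes "open S" "open T" "f ` S \<subseteq> T" "Ck_on k f S" "Ck_on k g T"
  shows "Ck_on k (\<lambda>x. g (f x)) S"
  using assms(4,5)
proof (induction k arbitrary: g)
  case 0
  then show ?case using continuous_on_compose2[OF _ _ assms(3)] by simp
next
  case (Suc k)
  have g': "(g has_derivative frechet_derivative g (at (f x))) (at (f x))" if "x \<in> S" for x
    using Ck_on_Suc_has_derivative[OF Suc.prems(2) assms(2)] that assms(3) by auto
  have eq: "frechet_derivative g (at (f x)) w
      = (\<Sum>i\<in>UNIV. (w $ i) *\<^sub>R frechet_derivative g (at (f x)) (axis i 1))" if "x \<in> S" for x w
  proof -
    have "linear (frechet_derivative g (at (f x)))"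
      using g'[OF that] by (rule has_derivative_linear)
    then show ?thesis by (rule linear_basis_expansion)
  qed
  have f': "Ck_on k (\<lambda>x. frechet_derivative f (at x) v) S" for v
    by (rule Ck_on_Suc_derivative[OF Suc.prems(1)])
  show ?case
  proof (rule Ck_on_SucI[OF assms(1)])
    show "((\<lambda>x. g (f x)) has_derivative
        (\<lambda>v. frechet_derivative g (at (f x)) (frechet_derivative f (at x) v))) (at x)" if "x \<in> S" for x
      using diff_chain_at[OF Ck_on_Suc_has_derivative[OF Suc.prems(1) assms(1) that] g'[OF that]]
      by (simp add: o_def)
    have "Ck_on k (\<lambda>x. \<Sum>i\<in>UNIV. (frechet_derivative f (at x) v $ i) *\<^sub>R
        frechet_derivative g (at (f x)) (axis i 1)) S" for v
    proof (intro Ck_on_sum Ck_on_scaleR assms(1))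
      fix i
      show "Ck_on k (\<lambda>x. frechet_derivative f (at x) v $ i) S"
        by (rule iffD1[OF Ck_on_vec[OF assms(1)] f', rule_format])
      show "Ck_on k (\<lambda>x. frechet_derivative g (at (f x)) (axis i 1)) S"
        by (rule Suc.IH[OF Ck_on_SucD[OF Suc.prems(1)] Ck_on_Suc_derivative[OF Suc.prems(2)]])
    qed
    then show "Ck_on k (\<lambda>x. frechet_derivative g (at (f x)) (frechet_derivative f (at x) v)) S" for v
      by (rule Ck_on_cong[OF assms(1), rotated]) (rule eq[symmetric])
  qed
qed

lemma Ck_on_det:
  fixes a :: "'b::real_normed_vector \<Rightarrow> real^'n^'n"
  assumes "open S" "\<And>i j. Ck_on k (\<lambda>x. a x $ i $ j) S"
  shows "Ck_on k (\<lambda>x. det (a x)) S"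
  unfolding det_def by (intro Ck_on_sum Ck_on_mult Ck_on_prod Ck_on_const assms)

text \<open>About \<open>y\<close> only the pointwise equation is assumed. This fits both
  applications, where the solution is produced point by point: by \<open>inv_into\<close> for the
  inverse of a deformation, by \<open>representation\<close> for components in a frame.\<close>

lemma Ck_on_linear_system:
  fixes a :: "'b::real_normed_vector \<Rightarrow> real^'n^'n" and y b :: "'b \<Rightarrow> real^'n"
  assumes S: "open S" and a: "\<And>i j. Ck_on k (\<lambda>x. a x $ i $ j) S" and b: "Ck_on k b S"
    and inv: "\<And>x. x \<in> S \<Longrightarrow> det (a x) \<noteq> 0" and sol: "\<And>x. x \<in> S \<Longrightarrow> a x *v y x = b x"
  shows "Ck_on k y S"
proof -
  have b': "Ck_on k (\<lambda>x. b x $ i) S" for i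
    using b Ck_on_vec[OF S] by blast
  have cramer': "Ck_on k (\<lambda>x. det (\<chi> i j. if j = l then b x $ i else a x $ i $ j) * inverse (det (a x))) S" for l
  proof (intro Ck_on_mult Ck_on_inverse Ck_on_det S inv a)
    show "Ck_on k (\<lambda>x. (\<chi> i j. if j = l then b x $ i else a x $ i $ j) $ i $ j) S" for i j
      using a b' by (cases "j = l") auto
  qed
  have sol': "y x $ l = det (\<chi> i j. if j = l then b x $ i else a x $ i $ j) * inverse (det (a x))"
    if "x \<in> S" for x l
    using sol[OF that] cramer[OF inv[OF that], of "y x" "b x"] by (simp add: divide_inverse)
  have "Ck_on k (\<lambda>x. y x $ l) S" for l
    by (rule Ck_on_cong[OF S sol'[symmetric] cramer'])
  then show ?thesis
    unfolding Ck_on_vec[OF S] by blast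
qed

lemma det_nonzeroI:
  fixes a :: "real^'n^'n"
  assumes "\<And>z. a *v z = 0 \<Longrightarrow> z = 0"
  shows "det a \<noteq> 0"
  using assms matrix_left_invertible_ker[of a] by (auto simp: invertible_det_nz[symmetric] invertible_left_inverse)

section \<open>Tangent vectors in charts\<close>

lemma component_tvec [simp]:
  "component 0 c = 0" "component (v + w) c = component v c + component w c"
  "component (- v) c = - component v c" "component (v - w) c = component v c - component w c"
  "component (r *\<^sub>R v) c = r *\<^sub>R component v c"
  by (simp_all add: zero_tvec_def plus_tvec_def uminus_tvec_def minus_tvec_def scaleR_tvec_def)

lemma component_sum: "component (sum f I) c = (\<Sum>i\<in>I. component (f i) c)"
  by (induction I rule: infinite_finite_induct) auto

lemma matrix_of_components:
  "(\<chi> k i. component (G i) c $ k) *v z = component (\<Sum>i\<in>UNIV. (z $ i) *\<^sub>R G i) c"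
  by (simp add: vec_eq_iff matrix_vector_mult_def component_sum mult.commute)

text \<open>The coordinate isomorphism from \<open>real^'n\<close> onto the tangent space at
  \<open>p\<close>, inverse to reading off the column in \<open>c\<close>: the other columns are
  filled in by the Jacobians of the transition maps.\<close>

definition chart_lift ::
  "('a, 'n::finite) chart set \<Rightarrow> ('a, 'n) chart \<Rightarrow> 'a \<Rightarrow> real^'n \<Rightarrow> ('a, 'n) tvec" where
  "chart_lift A c p x = TVec (\<lambda>d. if d \<in> A \<and> p \<in> fst d
     then frechet_derivative (snd d \<circ> chart_inv c) (at (snd c p)) x else 0)"

lemma tangent_spaceD:
  assumes "v \<in> tangent_space A p" "c \<in> A" "d \<in> A" "p \<in> fst c" "p \<in> fst d"
  shows "frechet_derivative (snd d \<circ> chart_inv c) (at (snd c p)) (component v c) = component v d"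
proof -
  have "component v d = frechet_derivative (snd d \<circ> chart_inv c) (at (snd c p)) (component v c)"
    using assms unfolding tangent_space_def by blast
  then show ?thesis by (rule sym)
qed

lemma chart_lift_component:
  assumes "v \<in> tangent_space A p" "c \<in> A" "p \<in> fst c"
  shows "chart_lift A c p (component v c) = v"
proof (rule tvec.expand, rule ext)
  fix d
  show "component (chart_lift A c p (component v c)) d = component v d"
  proof (cases "d \<in> A \<and> p \<in> fst d")
    case True
    then show ?thesis
      using tangent_spaceD[OF assms(1,2) _ assms(3), of d] by (simp add: chart_lift_def)
  next
    case False
    then have "component v d = 0"
      using assms(1) unfolding tangent_space_def by blast
    with False show ?thesis by (auto simp: chart_lift_def)
  qed
qed

lemma tangent_vector_eqI:
  assumes "v \<in> tangent_space A p" "w \<in> tangent_space A p" "c \<in> A" "p \<in> fst c"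
    and "component v c = component w c"
  shows "v = w"
proof -
  have "chart_lift A c p (component v c) = chart_lift A c p (component w c)"
    by (simp only: assms(5))
  then show ?thesis
    by (simp only: chart_lift_component[OF assms(1,3,4)] chart_lift_component[OF assms(2,3,4)])
qed

section \<open>Transition maps and the linear structure of the tangent spaces\<close>

locale manifold =
  fixes M :: "'a topology" and A :: "('a, 'n::finite) chart set"
  assumes smooth_manifold: "smooth_manifold M A"
begin

lemma openin_chart_domain: "c \<in> A \<Longrightarrow> openin M (fst c)"
  using smooth_manifold by (auto simp: smooth_manifold_def)

lemma chart_cover: "p \<in> topspace M \<Longrightarrow> \<exists>c\<in>A. p \<in> fst c"
  using smooth_manifold by (auto simp: smooth_manifold_def)

lemma openin_imp_topspace: "openin M U \<Longrightarrow> p \<in> U \<Longrightarrow> p \<in> topspace M"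
  using openin_subset by blast

lemma homeomorphic_chart:
  "c \<in> A \<Longrightarrow> homeomorphic_map (subtopology M (fst c)) (top_of_set (snd c ` fst c)) (snd c)"
  using smooth_manifold by (auto simp: smooth_manifold_def)

lemma chart_inv_chart [simp]:
  assumes "c \<in> A" "p \<in> fst c"
  shows "chart_inv c (snd c p) = p"
proof -
  have "topspace (subtopology M (fst c)) = fst c"
    using openin_subset[OF openin_chart_domain[OF assms(1)]] by auto
  then have "inj_on (snd c) (fst c)"
    using homeomorphic_imp_injective_map[OF homeomorphic_chart[OF assms(1)]] by simp
  then show ?thesis
    using assms(2) by (simp add: chart_inv_def)
qed

lemma open_chart_image:
  assumes "c \<in> A" "openin M U"
  shows "open (snd c ` (U \<inter> fst c))"
proof -
  have "openin (subtopology M (fst c)) (U \<inter> fst c)"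
    using assms(2) by (auto simp: openin_subtopology)
  then have "openin (top_of_set (snd c ` fst c)) (snd c ` (U \<inter> fst c))"
    using homeomorphic_imp_open_map[OF homeomorphic_chart[OF assms(1)]] by (simp add: open_map_def)
  moreover have "open (snd c ` fst c)"
    using smooth_manifold assms(1) by (auto simp: smooth_manifold_def)
  ultimately show ?thesis
    by (rule openin_open_trans)
qed

lemma transition_smooth:
  "c \<in> A \<Longrightarrow> d \<in> A \<Longrightarrow> Ck_on k (snd d \<circ> chart_inv c) (snd c ` (fst c \<inter> fst d))"
  using smooth_manifold by (auto simp: smooth_manifold_def smooth_on_def)

lemma open_overlap:
  assumes "c \<in> A" "d \<in> A"
  shows "open (snd c ` (fst c \<inter> fst d))"
  using open_chart_image[OF assms(1) openin_chart_domain[OF assms(2)]] by (simp add: Int_commute)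

lemma transition_has_derivative:
  assumes "c \<in> A" "d \<in> A" "p \<in> fst c" "p \<in> fst d"
  shows "((snd d \<circ> chart_inv c) has_derivative
    frechet_derivative (snd d \<circ> chart_inv c) (at (snd c p))) (at (snd c p))"
  using assms by (intro Ck_on_Suc_has_derivative[OF transition_smooth[of c d "Suc 0"] open_overlap]) auto

lemma linear_transition_derivative:
  assumes "c \<in> A" "d \<in> A" "p \<in> fst c" "p \<in> fst d"
  shows "linear (frechet_derivative (snd d \<circ> chart_inv c) (at (snd c p)))"
  using transition_has_derivative[OF assms] by (rule has_derivative_linear)

text \<open>Chain rule for transition maps. The composite collapses to the direct transition map
  where \<open>chart_inv d\<close> undoes \<open>snd d\<close>, so the derivative is transferred on
  an open set over the overlap. This is what makes the columns of a \<open>chart_lift\<close>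
  consistent between any two charts.\<close>

lemma transition_cocycle:
  assumes "c \<in> A" "d \<in> A" "e \<in> A" "p \<in> fst c" "p \<in> fst d" "p \<in> fst e"
  shows "frechet_derivative (snd e \<circ> chart_inv c) (at (snd c p)) x =
    frechet_derivative (snd e \<circ> chart_inv d) (at (snd d p))
      (frechet_derivative (snd d \<circ> chart_inv c) (at (snd c p)) x)"
proof -
  let ?S = "snd c ` ((fst d \<inter> fst e) \<inter> fst c)"
  have "((snd e \<circ> chart_inv d) \<circ> (snd d \<circ> chart_inv c) has_derivative
      frechet_derivative (snd e \<circ> chart_inv d) (at (snd d p)) \<circ>
      frechet_derivative (snd d \<circ> chart_inv c) (at (snd c p))) (at (snd c p))"
    using diff_chain_at[OF transition_has_derivative[of c d p], of "snd e \<circ> chart_inv d"]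
      transition_has_derivative[of d e p] assms by simp
  then have "((snd e \<circ> chart_inv c) has_derivative
      frechet_derivative (snd e \<circ> chart_inv d) (at (snd d p)) \<circ>
      frechet_derivative (snd d \<circ> chart_inv c) (at (snd c p))) (at (snd c p))"
  proof (rule has_derivative_transform_within_open)
    show "open ?S"
      using assms by (intro open_chart_image openin_Int openin_chart_domain)
  qed (use assms in auto)
  from fun_cong[OF frechet_derivative_at[OF this], of x] show ?thesis
    by simp
qed

lemma transition_self:
  assumes "c \<in> A" "p \<in> fst c"
  shows "frechet_derivative (snd c \<circ> chart_inv c) (at (snd c p)) x = x"
proof -
  have "((snd c \<circ> chart_inv c) has_derivative (\<lambda>x. x)) (at (snd c p))"
  proof (rule has_derivative_transform_within_open[OF has_derivative_ident])
    show "open (snd c ` (fst c \<inter> fst c))"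
      using assms by (intro open_overlap)
  qed (use assms in auto)
  from frechet_derivative_at[OF this, symmetric] show ?thesis by simp
qed

lemma subspace_tangent_space: "subspace (tangent_space A p)"
  unfolding subspace_def
proof (intro conjI ballI allI)
  have outside: "component v c = 0" if "v \<in> tangent_space A p" "c \<notin> A \<or> p \<notin> fst c" for v c
    using that unfolding tangent_space_def by blast
  note linear = linear_transition_derivative[of _ _ p]
  show "0 \<in> tangent_space A p"
    using linear_0[OF linear] by (simp add: tangent_space_def)
  show "u + v \<in> tangent_space A p" if "u \<in> tangent_space A p" "v \<in> tangent_space A p" for u v
    using linear_add[OF linear] outside[OF that(1)] outside[OF that(2)]
      tangent_spaceD[OF that(1)] tangent_spaceD[OF that(2)]
    unfolding tangent_space_def[of A p] by simp
  show "r *\<^sub>R v \<in> tangent_space A p" if "v \<in> tangent_space A p" for r v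
    using linear_scale[OF linear] outside[OF that] tangent_spaceD[OF that]
    unfolding tangent_space_def[of A p] by simp
qed

lemmas tangent_space_0 [simp] = subspace_0[OF subspace_tangent_space]
lemmas tangent_space_add = subspace_add[OF subspace_tangent_space]
lemmas tangent_space_scale = subspace_scale[OF subspace_tangent_space]
lemmas tangent_space_sum = subspace_sum[OF subspace_tangent_space]

lemma component_chart_lift:
  "c \<in> A \<Longrightarrow> p \<in> fst c \<Longrightarrow> component (chart_lift A c p x) c = x"
  by (simp add: chart_lift_def transition_self)

lemma chart_lift_tangent:
  assumes "c \<in> A" "p \<in> fst c"
  shows "chart_lift A c p x \<in> tangent_space A p"
  unfolding tangent_space_def mem_Collect_eq
proof (intro conjI allI ballI impI)
  show "component (chart_lift A c p x) d = 0" if "d \<notin> A \<or> p \<notin> fst d" for d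
    using that by (auto simp: chart_lift_def)
  show "component (chart_lift A c p x) e =
      frechet_derivative (snd e \<circ> chart_inv d) (at (snd d p)) (component (chart_lift A c p x) d)"
    if "d \<in> A" "e \<in> A" "p \<in> fst d" "p \<in> fst e" for d e
    using that by (simp add: chart_lift_def transition_cocycle[OF assms(1) that(1,2) assms(2) that(3,4)])
qed

lemma linear_chart_lift:
  assumes "c \<in> A" "p \<in> fst c"
  shows "linear (chart_lift A c p)"
  by (rule linearI; rule tangent_vector_eqI[OF chart_lift_tangent[OF assms] _ assms])
    (auto simp: assms component_chart_lift chart_lift_tangent tangent_space_add tangent_space_scale)

section \<open>Smooth vector fields\<close>

lemma smooth_fieldD:
  assumes "smooth_field M A U V"
  shows "openin M U" "p \<in> U \<Longrightarrow> V p \<in> tangent_space A p"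
    "c \<in> A \<Longrightarrow> Ck_on k (\<lambda>x. component (V (chart_inv c x)) c) (snd c ` (U \<inter> fst c))"
  using assms by (auto simp: smooth_field_def smooth_on_def)

lemma smooth_field_add:
  assumes "smooth_field M A U V" "smooth_field M A U W"
  shows "smooth_field M A U (\<lambda>p. V p + W p)"
  unfolding smooth_field_def smooth_on_def
  using smooth_fieldD[OF assms(1)] smooth_fieldD[OF assms(2)]
  by (auto intro!: tangent_space_add Ck_on_add open_chart_image)

lemma smooth_field_zero: "openin M U \<Longrightarrow> smooth_field M A U (\<lambda>p. 0)"
  by (simp add: smooth_field_def smooth_on_def Ck_on_const)

lemma smooth_field_scale:
  assumes "smooth_function M A U f" "smooth_field M A U V"
  shows "smooth_field M A U (\<lambda>p. f p *\<^sub>R V p)"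
  unfolding smooth_field_def smooth_on_def
  using assms(1) smooth_fieldD[OF assms(2)]
  by (auto intro!: tangent_space_scale Ck_on_scaleR open_chart_image
      simp: smooth_function_def smooth_on_def o_def)

lemma smooth_field_sum:
  assumes "openin M U" "\<And>i. i \<in> I \<Longrightarrow> smooth_field M A U (V i)"
  shows "smooth_field M A U (\<lambda>p. \<Sum>i\<in>I. V i p)"
  using assms(2)
  by (induction I rule: infinite_finite_induct)
    (simp_all add: smooth_field_zero[OF assms(1)] smooth_field_add)

text \<open>These are the fields with constant column \<open>x\<close> in the chart
  \<open>c\<close>. Seen from another chart \<open>d\<close>, the column is a directional derivative
  of the transition from \<open>c\<close> to \<open>d\<close>, composed with the transition back.
  They serve as local test fields: applying a deformation to them exhibits its matrix in
  \<open>c\<close> as smooth.\<close>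

lemma smooth_field_chart_lift:
  assumes c: "c \<in> A" and W: "openin M W" "W \<subseteq> fst c"
  shows "smooth_field M A W (\<lambda>p. chart_lift A c p x)"
  unfolding smooth_field_def smooth_on_def
proof (intro conjI ballI allI)
  fix d k assume d: "d \<in> A"
  have "Ck_on k (\<lambda>y. frechet_derivative (snd d \<circ> chart_inv c) (at ((snd c \<circ> chart_inv d) y)) x)
      (snd d ` (W \<inter> fst d))"
  proof (rule Ck_on_compose[OF open_chart_image[OF d W(1)] open_overlap[OF c d],
        where f = "snd c \<circ> chart_inv d"])
    show "Ck_on k (snd c \<circ> chart_inv d) (snd d ` (W \<inter> fst d))"
      by (rule Ck_on_subset[OF transition_smooth[OF d c]]) (use W(2) in auto)
    show "Ck_on k (\<lambda>z. frechet_derivative (snd d \<circ> chart_inv c) (at z) x)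
        (snd c ` (fst c \<inter> fst d))"
      by (rule Ck_on_Suc_derivative[OF transition_smooth[OF c d]])
  qed (use W(2) d in auto)
  then show "Ck_on k (\<lambda>y. component (chart_lift A c (chart_inv d y) x) d) (snd d ` (W \<inter> fst d))"
    by (rule Ck_on_cong[OF open_chart_image[OF d W(1)], rotated]) (use d in \<open>auto simp: chart_lift_def\<close>)
qed (use W chart_lift_tangent[OF c] in auto)

section \<open>Deformation fields\<close>

lemma deformation_fieldD:
  assumes "deformation_field M A P"
  shows "p \<in> topspace M \<Longrightarrow> bij_betw (P p) (tangent_space A p) (tangent_space A p)"
    "p \<in> topspace M \<Longrightarrow> u \<in> tangent_space A p \<Longrightarrow> P p u \<in> tangent_space A p"
    "smooth_field M A U V \<Longrightarrow> smooth_field M A U (\<lambda>p. P p (V p))"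
  using assms by (auto simp: deformation_field_def dest: bij_betw_apply)

text \<open>Linearity of \<open>P p\<close> is given on the tangent space only. Precomposing with
  \<open>chart_lift\<close> of the column in one chart, a linear map that fixes tangent vectors,
  extends it to all of \<open>tvec\<close>, where the general theory of linear maps applies.\<close>

lemma deformation_field_linear:
  assumes "deformation_field M A P" "p \<in> topspace M"
  obtains L where "linear L" "\<And>u. u \<in> tangent_space A p \<Longrightarrow> P p u = L u"
proof -
  obtain c where c: "c \<in> A" "p \<in> fst c"
    using chart_cover[OF assms(2)] by blast
  have P: "P p (r *\<^sub>R u + v) = r *\<^sub>R P p u + P p v"
    if "u \<in> tangent_space A p" "v \<in> tangent_space A p" for r u v
    using assms that by (auto simp: deformation_field_def)
  have 0: "P p 0 = 0"
    using P[of 0 0 1] by simp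
  let ?L = "\<lambda>u. P p (chart_lift A c p (component u c))"
  have "linear ?L"
  proof (rule linearI)
    show "?L (u + v) = ?L u + ?L v" for u v
      using P[of "chart_lift A c p (component u c)" "chart_lift A c p (component v c)" 1]
      by (simp add: c chart_lift_tangent linear_add[OF linear_chart_lift])
    show "?L (r *\<^sub>R u) = r *\<^sub>R ?L u" for r u
      using P[of "chart_lift A c p (component u c)" 0 r]
      by (simp add: c 0 chart_lift_tangent linear_scale[OF linear_chart_lift])
  qed
  then show thesis
    by (rule that) (simp add: c chart_lift_component)
qed

lemma deformation_field_sum:
  assumes "deformation_field M A P" "p \<in> topspace M" "\<And>i. i \<in> I \<Longrightarrow> u i \<in> tangent_space A p"
  shows "P p (\<Sum>i\<in>I. r i *\<^sub>R u i) = (\<Sum>i\<in>I. r i *\<^sub>R P p (u i))"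
proof -
  obtain L where L: "linear L" "\<And>u. u \<in> tangent_space A p \<Longrightarrow> P p u = L u"
    using deformation_field_linear[OF assms(1,2)] by blast
  have "(\<Sum>i\<in>I. r i *\<^sub>R u i) \<in> tangent_space A p"
    by (intro tangent_space_sum tangent_space_scale assms(3))
  then show ?thesis
    using assms(3) by (simp add: L linear_sum[OF L(1)] linear_scale[OF L(1)])
qed

lemma deformation_field_lincomb:
  assumes "deformation_field M A P" "p \<in> topspace M" "u \<in> tangent_space A p" "v \<in> tangent_space A p"
  shows "P p (u + v) = P p u + P p v" "P p (r *\<^sub>R u) = r *\<^sub>R P p u" "P p 0 = 0"
proof -
  obtain L where L: "linear L" "\<And>u. u \<in> tangent_space A p \<Longrightarrow> P p u = L u"
    using deformation_field_linear[OF assms(1,2)] by blast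
  show "P p (u + v) = P p u + P p v" "P p (r *\<^sub>R u) = r *\<^sub>R P p u" "P p 0 = 0"
    using L(1) assms(3,4) by (simp_all add: L tangent_space_add tangent_space_scale linear_add linear_scale linear_0)
qed

lemma deformation_field_eq_0:
  assumes "deformation_field M A P" "p \<in> topspace M" "u \<in> tangent_space A p" "P p u = 0"
  shows "u = 0"
proof -
  have "inj_on (P p) (tangent_space A p)"
    using deformation_fieldD(1)[OF assms(1,2)] by (rule bij_betw_imp_inj_on)
  then show ?thesis
    using inj_onD[of "P p" "tangent_space A p" u 0] assms
      deformation_field_lincomb(3)[OF assms(1-3,3)] by simp
qed

lemma deformation_field_compose:
  assumes "deformation_field M A P" "deformation_field M A Q"
  shows "deformation_field M A (\<lambda>p. P p \<circ> Q p)"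
  unfolding deformation_field_def
proof (intro conjI ballI allI impI)
  fix p assume p: "p \<in> topspace M"
  show "bij_betw (P p \<circ> Q p) (tangent_space A p) (tangent_space A p)"
    using assms p by (intro bij_betw_trans[of _ _ "tangent_space A p"] deformation_fieldD(1))
  show "(P p \<circ> Q p) (r *\<^sub>R u + v) = r *\<^sub>R (P p \<circ> Q p) u + (P p \<circ> Q p) v"
    if "u \<in> tangent_space A p" "v \<in> tangent_space A p" for u v r
    using p that by (simp add: deformation_field_lincomb[OF assms(1)] deformation_field_lincomb[OF assms(2)]
        deformation_fieldD(2)[OF assms(2)] tangent_space_scale)
qed (auto intro: deformation_fieldD(3)[OF assms(1)] deformation_fieldD(3)[OF assms(2)])

lemma smooth_field_inverse:
  assumes P: "deformation_field M A P" and V: "smooth_field M A U V"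
  shows "smooth_field M A U (\<lambda>p. inv_into (tangent_space A p) (P p) (V p))"
  unfolding smooth_field_def smooth_on_def
proof (intro conjI ballI allI)
  let ?Y = "\<lambda>p. inv_into (tangent_space A p) (P p) (V p)"
  note U = smooth_fieldD(1)[OF V]
  have bij: "bij_betw (P p) (tangent_space A p) (tangent_space A p)" if "p \<in> U" for p
    using deformation_fieldD(1)[OF P openin_imp_topspace[OF U that]] .
  show Y: "?Y p \<in> tangent_space A p" if "p \<in> U" for p
    using bij_betw_apply[OF bij_betw_inv_into[OF bij[OF that]]] smooth_fieldD(2)[OF V that] by blast
  have PY: "P p (?Y p) = V p" if "p \<in> U" for p
    using bij_betw_inv_into_right[OF bij[OF that]] smooth_fieldD(2)[OF V that] by blast
  show "openin M U" by (rule U)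
  fix c k assume c: "c \<in> A"
  let ?W = "U \<inter> fst c"
  let ?G = "\<lambda>i p. P p (chart_lift A c p (axis i 1))"
  \<comment> \<open>The matrix of \<open>P\<close> in the chart \<open>c\<close>: column
    \<open>i\<close> is the image of the \<open>i\<close>-th coordinate field. The column of the
    preimage of \<open>V\<close> solves the system with this matrix and the column of
    \<open>V\<close> as right-hand side.\<close>
  let ?a = "\<lambda>x. \<chi> j i. component (?G i (chart_inv c x)) c $ j"
  have W: "openin M ?W"
    using U openin_chart_domain[OF c] by blast
  have expand: "?a (snd c p) *v z = component (P p (chart_lift A c p z)) c" if p: "p \<in> ?W" for p z
  proof -
    have "chart_lift A c p z = (\<Sum>i\<in>UNIV. (z $ i) *\<^sub>R chart_lift A c p (axis i 1))"
      using linear_basis_expansion[OF linear_chart_lift] c p by blast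
    then show ?thesis
      using p c U deformation_field_sum[OF P openin_imp_topspace[OF U], of p UNIV "\<lambda>i. chart_lift A c p (axis i 1)"]
      by (simp add: matrix_of_components chart_lift_tangent)
  qed
  show "Ck_on k (\<lambda>x. component (?Y (chart_inv c x)) c) (snd c ` ?W)"
  proof (rule Ck_on_linear_system[OF open_chart_image[OF c U] _ smooth_fieldD(3)[OF V c]])
    fix i j
    have "smooth_field M A ?W (?G j)"
      by (intro deformation_fieldD(3)[OF P] smooth_field_chart_lift c W) auto
    from smooth_fieldD(3)[OF this c, of k]
    have "Ck_on k (\<lambda>x. component (?G j (chart_inv c x)) c) (snd c ` ?W)"
      by simp
    from iffD1[OF Ck_on_vec[OF open_chart_image[OF c U]] this, rule_format, of i]
    show "Ck_on k (\<lambda>x. ?a x $ i $ j) (snd c ` ?W)" by simp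
  next
    fix x assume "x \<in> snd c ` ?W"
    then obtain p where p: "p \<in> ?W" "x = snd c p" by blast
    then have lift: "chart_lift A c p z \<in> tangent_space A p" for z
      using c chart_lift_tangent by blast
    have top: "p \<in> topspace M" using p U openin_imp_topspace by blast
    show "det (?a x) \<noteq> 0"
    proof (rule det_nonzeroI)
      fix z assume "?a x *v z = 0"
      then have "component (P p (chart_lift A c p z)) c = component 0 c"
        using expand[OF p(1)] p(2) by simp
      then have "P p (chart_lift A c p z) = 0"
        using tangent_vector_eqI[of _ A p 0 c] p c deformation_fieldD(2)[OF P top lift] by simp
      then have "chart_lift A c p z = 0"
        using deformation_field_eq_0[OF P top lift] by blast
      then show "z = 0"
        using component_chart_lift[of c p z] p c by simp
    qed
    show "?a x *v component (?Y (chart_inv c x)) c = component (V (chart_inv c x)) c"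
      using expand[OF p(1), of "component (?Y p) c"] p c PY[of p] chart_lift_component[OF Y, of p c]
      by simp
  qed
qed

text \<open>With the inverse itself a deformation, the natural connection is a deformation applied
  to a derivative, so smoothness and linearity carry over; the comparison of signatures also becomes
  symmetric.\<close>

lemma deformation_field_inverse:
  assumes P: "deformation_field M A P"
  shows "deformation_field M A (\<lambda>p. inv_into (tangent_space A p) (P p))"
  unfolding deformation_field_def
proof (intro conjI ballI allI impI)
  fix p assume p: "p \<in> topspace M"
  note bij = deformation_fieldD(1)[OF P p]
  let ?Q = "inv_into (tangent_space A p) (P p)"
  show "bij_betw ?Q (tangent_space A p) (tangent_space A p)"
    by (rule bij_betw_inv_into[OF bij])
  fix u v r assume u: "u \<in> tangent_space A p" and v: "v \<in> tangent_space A p"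
  have Q: "?Q u \<in> tangent_space A p" "?Q v \<in> tangent_space A p"
    using bij_betw_apply[OF bij_betw_inv_into[OF bij]] u v by auto
  have "P p (r *\<^sub>R ?Q u + ?Q v) = r *\<^sub>R u + v"
    using Q u v bij by (simp add: deformation_field_lincomb[OF P p] tangent_space_scale bij_betw_inv_into_right)
  then show "?Q (r *\<^sub>R u + v) = r *\<^sub>R ?Q u + ?Q v"
    using bij_betw_inv_into_left[OF bij tangent_space_add[OF tangent_space_scale[OF Q(1)] Q(2)]]
    by metis
qed (rule smooth_field_inverse[OF P])

end

section \<open>Deformed geometries\<close>

text \<open>The definition quantifies over a pair of fields throughout. For the clauses that concern
  \<open>V\<close> alone, later uses supply the same field twice.\<close>

lemma affine_connectionD:
  assumes "affine_connection M A D" "smooth_field M A U V" "smooth_field M A U W"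
  shows "smooth_field M A U (\<lambda>p. D p (W p) V)"
    and "p \<in> U \<Longrightarrow> v \<in> tangent_space A p \<Longrightarrow> D p v V \<in> tangent_space A p"
    and "p \<in> U \<Longrightarrow> v \<in> tangent_space A p \<Longrightarrow> (\<And>q. q \<in> U \<Longrightarrow> V q = W q) \<Longrightarrow> D p v V = D p v W"
    and "p \<in> U \<Longrightarrow> v \<in> tangent_space A p \<Longrightarrow> D p v (\<lambda>q. V q + W q) = D p v V + D p v W"
    and "p \<in> U \<Longrightarrow> v \<in> tangent_space A p \<Longrightarrow> smooth_function M A U f \<Longrightarrow>
      D p v (\<lambda>q. f q *\<^sub>R V q) = differential A f p v *\<^sub>R V p + f p *\<^sub>R D p v V"
    and "p \<in> U \<Longrightarrow> v \<in> tangent_space A p \<Longrightarrow> w \<in> tangent_space A p \<Longrightarrow>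
      D p (r *\<^sub>R v + w) V = r *\<^sub>R D p v V + D p w V"
  using assms unfolding affine_connection_def by blast+

context manifold
begin

lemma affine_connection_sum:
  assumes D: "affine_connection M A D" and V: "\<And>i. i \<in> I \<Longrightarrow> smooth_field M A U (V i)"
    and U: "openin M U" and p: "p \<in> U" "v \<in> tangent_space A p"
  shows "D p v (\<lambda>q. \<Sum>i\<in>I. V i q) = (\<Sum>i\<in>I. D p v (V i))"
proof -
  have "D p v (\<lambda>q. 0) = 0"
    using affine_connectionD(4)[OF D smooth_field_zero[OF U] smooth_field_zero[OF U] p] by simp
  with V show ?thesis
    by (induction I rule: infinite_finite_induct)
      (simp_all add: affine_connectionD(4)[OF D _ smooth_field_sum[OF U] p])
qed

lemma natural_connection:
  assumes D: "affine_connection M A D" and P: "deformation_field M A P"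
    and V: "smooth_field M A U V" and p: "p \<in> U" "v \<in> tangent_space A p"
  shows "natural_connection A P D p v V \<in> tangent_space A p"
    "P p (natural_connection A P D p v V) = D p v (\<lambda>q. P q (V q))"
proof -
  note PV = deformation_fieldD(3)[OF P V]
  have bij: "bij_betw (P p) (tangent_space A p) (tangent_space A p)"
    using deformation_fieldD(1)[OF P openin_imp_topspace[OF smooth_fieldD(1)[OF V] p(1)]] .
  have DPV: "D p v (\<lambda>q. P q (V q)) \<in> tangent_space A p"
    by (rule affine_connectionD(2)[OF D PV PV p])
  show "natural_connection A P D p v V \<in> tangent_space A p"
    unfolding natural_connection_def by (rule bij_betw_apply[OF bij_betw_inv_into[OF bij] DPV])
  show "P p (natural_connection A P D p v V) = D p v (\<lambda>q. P q (V q))"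
    unfolding natural_connection_def by (rule bij_betw_inv_into_right[OF bij DPV])
qed

text \<open>A function factor passes through \<open>P\<close>, the Leibniz rule of \<open>D\<close>
  produces the term with its differential times \<open>P V\<close>, and the inverse of
  \<open>P\<close> turns \<open>P V\<close> back into \<open>V\<close>. The result lets the deformed
  connection act as reference for the next stage.\<close>

lemma affine_natural_connection:
  assumes D: "affine_connection M A D" and P: "deformation_field M A P"
  shows "affine_connection M A (natural_connection A P D)"
  unfolding affine_connection_def
proof (intro allI impI conjI ballI)
  let ?N = "natural_connection A P D"
  let ?Q = "\<lambda>p. inv_into (tangent_space A p) (P p)"
  fix U V W assume V: "smooth_field M A U V" and W: "smooth_field M A U W"
  note U = smooth_fieldD(1)[OF V]
  note PV = deformation_fieldD(3)[OF P V] and PW = deformation_fieldD(3)[OF P W]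
  note Q = deformation_field_inverse[OF P]
  show "smooth_field M A U (\<lambda>p. ?N p (W p) V)"
    unfolding natural_connection_def
    by (rule deformation_fieldD(3)[OF Q affine_connectionD(1)[OF D PV W]])
  fix p v assume p: "p \<in> U" "v \<in> tangent_space A p"
  have top: "p \<in> topspace M" using openin_imp_topspace U p(1) by blast
  have T: "D p v (\<lambda>q. P q (V q)) \<in> tangent_space A p" "D p v (\<lambda>q. P q (W q)) \<in> tangent_space A p"
    by (rule affine_connectionD(2)[OF D PV PV p] affine_connectionD(2)[OF D PW PW p])+
  have lin: "P q (V q + W q) = P q (V q) + P q (W q)" "P q (r *\<^sub>R V q) = r *\<^sub>R P q (V q)"
    if "q \<in> U" for q r
    by (rule deformation_field_lincomb[OF P openin_imp_topspace[OF U that]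
          smooth_fieldD(2)[OF V that] smooth_fieldD(2)[OF W that]])+
  show "?N p v V \<in> tangent_space A p"
    by (rule natural_connection(1)[OF D P V p])
  show "?N p v V = ?N p v W" if "\<forall>q\<in>U. V q = W q"
    unfolding natural_connection_def
    using affine_connectionD(3)[OF D PV PW p] that by simp
  \<comment> \<open>Outside \<open>U\<close> the values of \<open>V\<close> and \<open>W\<close>
    need not be tangent, so the two arguments of \<open>D\<close> agree on \<open>U\<close> only;
    the locality clause replaces rewriting.\<close>
  have "D p v (\<lambda>q. P q (V q + W q)) = D p v (\<lambda>q. P q (V q) + P q (W q))"
    by (rule affine_connectionD(3)[OF D deformation_fieldD(3)[OF P smooth_field_add[OF V W]]
          smooth_field_add[OF PV PW] p lin(1)])
  then show "?N p v (\<lambda>q. V q + W q) = ?N p v V + ?N p v W"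
    unfolding natural_connection_def
    using affine_connectionD(4)[OF D PV PW p] deformation_field_lincomb(1)[OF Q top T] by simp
  show "?N p v (\<lambda>q. f q *\<^sub>R V q) = differential A f p v *\<^sub>R V p + f p *\<^sub>R ?N p v V"
    if f: "smooth_function M A U f" for f
  proof -
    have "D p v (\<lambda>q. P q (f q *\<^sub>R V q)) = D p v (\<lambda>q. f q *\<^sub>R P q (V q))"
      by (rule affine_connectionD(3)[OF D deformation_fieldD(3)[OF P smooth_field_scale[OF f V]]
            smooth_field_scale[OF f PV] p lin(2)])
    also have "\<dots> = differential A f p v *\<^sub>R P p (V p) + f p *\<^sub>R D p v (\<lambda>q. P q (V q))"
      by (rule affine_connectionD(5)[OF D PV PV p f])
    finally have "?N p v (\<lambda>q. f q *\<^sub>R V q) =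
        ?Q p (differential A f p v *\<^sub>R P p (V p) + f p *\<^sub>R D p v (\<lambda>q. P q (V q)))"
      by (simp add: natural_connection_def)
    also have "\<dots> = differential A f p v *\<^sub>R ?Q p (P p (V p)) + f p *\<^sub>R ?N p v V"
      using smooth_fieldD(2)[OF PV p(1)] T(1)
      by (simp add: natural_connection_def tangent_space_scale deformation_field_lincomb(1)[OF Q top]
          deformation_field_lincomb(2)[OF Q top _ tangent_space_0])
    also have "?Q p (P p (V p)) = V p"
      by (rule bij_betw_inv_into_left[OF deformation_fieldD(1)[OF P top] smooth_fieldD(2)[OF V p(1)]])
    finally show ?thesis .
  qed
  show "?N p (r *\<^sub>R v + w) V = r *\<^sub>R ?N p v V + ?N p w V" if w: "w \<in> tangent_space A p" for w r
    using affine_connectionD(2)[OF D PV PV p(1) w] T(1)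
    by (simp add: natural_connection_def affine_connectionD(6)[OF D PV PV p w] tangent_space_scale
        deformation_field_lincomb(1)[OF Q top] deformation_field_lincomb(2)[OF Q top _ tangent_space_0])
qed

lemma natural_connection_compose:
  assumes D: "affine_connection M A D" and P: "deformation_field M A P" and Q: "deformation_field M A Q"
    and V: "smooth_field M A U V" and p: "p \<in> U" "v \<in> tangent_space A p"
  shows "natural_connection A (\<lambda>p. P p \<circ> Q p) D p v V =
    natural_connection A Q (natural_connection A P D) p v V"
proof -
  let ?N = "natural_connection A Q (natural_connection A P D) p v V"
  note top = openin_imp_topspace[OF smooth_fieldD(1)[OF V] p(1)]
  note ND = affine_natural_connection[OF D P]
  \<comment> \<open>Instead of unfolding nested inverses, the twice deformed derivative is pushed
    forward by the composite; injectivity of the composite then identifies it.\<close>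
  have "(P p \<circ> Q p) ?N = D p v (\<lambda>q. (P q \<circ> Q q) (V q))"
    using natural_connection(2)[OF ND Q V p] natural_connection(2)[OF D P deformation_fieldD(3)[OF Q V] p]
    by simp
  then show ?thesis
    using bij_betw_inv_into_left[OF deformation_fieldD(1)[OF deformation_field_compose[OF P Q] top]
        natural_connection(1)[OF ND Q V p]]
    by (simp add: natural_connection_def)
qed

section \<open>Signature, nondegeneracy and compatibility of deformed metrics\<close>

lemma deformation_field_subspace_image:
  assumes P: "deformation_field M A P" and p: "p \<in> topspace M"
    and S: "subspace S" "S \<subseteq> tangent_space A p"
  shows "subspace (P p ` S)" "dim (P p ` S) = dim S" "P p ` S \<subseteq> tangent_space A p"
proof -
  obtain c where c: "c \<in> A" "p \<in> fst c"
    using chart_cover[OF p] by blast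
  obtain L where L: "linear L" "\<And>u. u \<in> tangent_space A p \<Longrightarrow> P p u = L u"
    using deformation_field_linear[OF P p] by blast
  note lift = linear_chart_lift[OF c]
  \<comment> \<open>The columns of \<open>S\<close> in \<open>real^'n\<close>, where dimension
    theory is available: \<open>S\<close> and its image under \<open>P p\<close> are both injective
    linear images of this space, hence of equal dimension.\<close>
  let ?S = "(\<lambda>v. component v c) ` S"
  have img: "P p ` S = L ` S"
    using L(2) S(2) by (auto simp: image_iff subset_iff)
  show "subspace (P p ` S)"
    unfolding img by (rule linear_subspace_image[OF L(1) S(1)])
  show "P p ` S \<subseteq> tangent_space A p"
    using S(2) deformation_fieldD(2)[OF P p] by blast
  have "linear (\<lambda>v. component v c :: real^'n)"
    by (rule linearI) simp_all
  then have subS: "subspace ?S"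
    by (rule linear_subspace_image[OF _ S(1)])
  have S_eq: "S = chart_lift A c p ` ?S"
    using S(2) chart_lift_component[OF _ c] by (force simp: image_image)
  have inj: "inj (chart_lift A c p)"
    by (rule inj_on_inverseI[of _ "\<lambda>v. component v c"]) (simp add: component_chart_lift[OF c])
  \<comment> \<open>The extension \<open>L\<close> is controlled on tangent vectors only; after
    \<open>chart_lift\<close> it is injective on all of \<open>real^'n\<close>.\<close>
  have injL: "inj (L \<circ> chart_lift A c p)"
  proof (rule injI)
    fix x y assume "(L \<circ> chart_lift A c p) x = (L \<circ> chart_lift A c p) y"
    then have "P p (chart_lift A c p x) = P p (chart_lift A c p y)"
      by (simp add: L(2) chart_lift_tangent[OF c])
    then have "chart_lift A c p x = chart_lift A c p y"
      using inj_onD[OF bij_betw_imp_inj_on[OF deformation_fieldD(1)[OF P p]]]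
        chart_lift_tangent[OF c] by blast
    then show "x = y" by (rule injD[OF inj])
  qed
  have "dim (P p ` S) = dim ((L \<circ> chart_lift A c p) ` ?S)"
    unfolding img by (subst S_eq) (simp only: image_comp o_assoc)
  also have "\<dots> = dim ?S"
    by (rule dim_image_eq[OF linear_compose[OF lift L(1)] inj_on_subset[OF injL subset_UNIV]])
  also have "\<dots> = dim (chart_lift A c p ` ?S)"
    by (rule dim_image_eq[OF lift inj_on_subset[OF inj subset_UNIV], symmetric])
  also have "\<dots> = dim S"
    by (simp only: S_eq[symmetric])
  finally show "dim (P p ` S) = dim S" .
qed

text \<open>A subspace negative definite for \<open>g\<close> has an image under \<open>P p\<close>
  that is negative definite for \<open>h\<close>, of the same dimension. Both forms are kept
  arbitrary, so that the inclusion can be used for \<open>P\<close> and, with the forms exchanged,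
  for its inverse.\<close>

lemma negative_dimensions_subset:
  assumes P: "deformation_field M A P" and p: "p \<in> topspace M"
    and g: "\<And>v. v \<in> tangent_space A p \<Longrightarrow> h p (P p v) (P p v) = g p v v"
  shows "{dim S | S. subspace S \<and> S \<subseteq> tangent_space A p \<and> (\<forall>v\<in>S. v \<noteq> 0 \<longrightarrow> g p v v < 0)} \<subseteq>
    {dim S | S. subspace S \<and> S \<subseteq> tangent_space A p \<and> (\<forall>v\<in>S. v \<noteq> 0 \<longrightarrow> h p v v < 0)}"
proof clarify
  fix S assume S: "subspace S" "S \<subseteq> tangent_space A p" and neg: "\<forall>v\<in>S. v \<noteq> 0 \<longrightarrow> g p v v < 0"
  have "h p (P p v) (P p v) < 0" if "v \<in> S" "P p v \<noteq> 0" for v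
  proof -
    have "v \<noteq> 0"
      using that deformation_field_lincomb(3)[OF P p tangent_space_0 tangent_space_0] by auto
    then show ?thesis using that neg g[of v] S(2) by auto
  qed
  then show "\<exists>S'. dim S = dim S' \<and> subspace S' \<and> S' \<subseteq> tangent_space A p \<and>
      (\<forall>v\<in>S'. v \<noteq> 0 \<longrightarrow> h p v v < 0)"
    using deformation_field_subspace_image[OF P p S] by (intro exI[of _ "P p ` S"]) auto
qed

text \<open>The two sets of attainable dimensions coincide, so their maxima do, and nothing about
  the maximum itself has to be shown.\<close>

lemma negative_index_deformed_metric:
  assumes P: "deformation_field M A P" and p: "p \<in> topspace M"
  shows "negative_index A (deformed_metric P g) p = negative_index A g p"
proof -
  have inverse: "deformed_metric P g p (inv_into (tangent_space A p) (P p) v)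
      (inv_into (tangent_space A p) (P p) v) = g p v v" if "v \<in> tangent_space A p" for v
    using bij_betw_inv_into_right[OF deformation_fieldD(1)[OF P p] that] by (simp add: deformed_metric_def)
  have deformed: "g p (P p v) (P p v) = deformed_metric P g p v v" for v
    by (simp add: deformed_metric_def)
  show ?thesis
    unfolding negative_index_def
    by (rule arg_cong[of _ _ Max], rule subset_antisym)
      (rule negative_dimensions_subset[where h = g and g = "deformed_metric P g", OF P p deformed]
        negative_dimensions_subset[where h = "deformed_metric P g" and g = g,
          OF deformation_field_inverse[OF P] p inverse])+
qed

lemma pseudo_riemannian_deformed_metric:
  assumes P: "deformation_field M A P" and g: "pseudo_riemannian_metric M A g"
  shows "pseudo_riemannian_metric M A (deformed_metric P g)"
  unfolding pseudo_riemannian_metric_def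
proof (intro conjI ballI allI impI)
  fix p assume p: "p \<in> topspace M"
  note PT = deformation_fieldD(2)[OF P p]
  have sym: "g p u v = g p v u" if "u \<in> tangent_space A p" "v \<in> tangent_space A p" for u v
    using conjunct1[OF g[unfolded pseudo_riemannian_metric_def], rule_format, OF p] that by blast
  have nondegenerate: "u = 0" if "u \<in> tangent_space A p" "\<And>v. v \<in> tangent_space A p \<Longrightarrow> g p u v = 0" for u
    using conjunct1[OF g[unfolded pseudo_riemannian_metric_def], rule_format, OF p] that by blast
  show "deformed_metric P g p (r *\<^sub>R u + v) w = r * deformed_metric P g p u w + deformed_metric P g p v w"
    if "u \<in> tangent_space A p" "v \<in> tangent_space A p" "w \<in> tangent_space A p" for u v w r
    using that g p PT
    by (simp add: deformed_metric_def pseudo_riemannian_metric_def tangent_space_scale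
        deformation_field_lincomb(1)[OF P p] deformation_field_lincomb(2)[OF P p _ tangent_space_0])
  show "deformed_metric P g p u v = deformed_metric P g p v u"
    if "u \<in> tangent_space A p" "v \<in> tangent_space A p" for u v
    unfolding deformed_metric_def by (rule sym[OF PT[OF that(1)] PT[OF that(2)]])
  show "u = 0" if u: "u \<in> tangent_space A p" and orth: "\<forall>v\<in>tangent_space A p. deformed_metric P g p u v = 0" for u
  proof (rule deformation_field_eq_0[OF P p u])
    \<comment> \<open>Surjectivity of \<open>P p\<close> enters here: \<open>w\<close> is the image
      of its preimage, on which orthogonality for the deformed metric is tested.\<close>
    have "g p (P p u) w = 0" if "w \<in> tangent_space A p" for w
    proof -
      note bij = deformation_fieldD(1)[OF P p]
      show ?thesis
        using bspec[OF orth bij_betw_apply[OF bij_betw_inv_into[OF bij] that]]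
        by (simp add: deformed_metric_def bij_betw_inv_into_right[OF bij that])
    qed
    then show "P p u = 0"
      by (rule nondegenerate[OF PT[OF u]])
  qed
next
  show "smooth_function M A U (\<lambda>p. deformed_metric P g p (V p) (W p))"
    if "smooth_field M A U V" "smooth_field M A U W" for U V W
    using g deformation_fieldD(3)[OF P that(1)] deformation_fieldD(3)[OF P that(2)]
    unfolding deformed_metric_def pseudo_riemannian_metric_def by blast
  show "\<exists>k. \<forall>p\<in>topspace M. negative_index A (deformed_metric P g) p = k"
    using g negative_index_deformed_metric[OF P] by (simp add: pseudo_riemannian_metric_def)
qed

text \<open>The conclusion has the shape of the first hypothesis, so the lemma can be iterated over
  successive deformations. Compatibility of the reference is evaluated on the fields
  \<open>P V\<close> and \<open>P W\<close>, which gives the same differential and the same two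
  correction terms.\<close>

lemma deformed_geometry:
  assumes geometry: "metric_compatible_geometry M A g D" and P: "deformation_field M A P"
  shows "metric_compatible_geometry M A (deformed_metric P g) (natural_connection A P D)"
proof -
  have D: "affine_connection M A D"
    using geometry by (simp add: metric_compatible_geometry_def)
  have "metric_compatible M A (deformed_metric P g) (natural_connection A P D)"
    unfolding metric_compatible_def
  proof (intro allI impI ballI)
    fix U V W p v
    assume V: "smooth_field M A U V" and W: "smooth_field M A U W" and p: "p \<in> U" "v \<in> tangent_space A p"
    have "metric_derivative A D g p v (\<lambda>q. P q (V q)) (\<lambda>q. P q (W q)) = 0"
      using geometry deformation_fieldD(3)[OF P V] deformation_fieldD(3)[OF P W] p
      unfolding metric_compatible_geometry_def metric_compatible_def by blast
    then show "metric_derivative A (natural_connection A P D) (deformed_metric P g) p v V W = 0"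
      by (simp add: metric_derivative_def deformed_metric_def
          natural_connection(2)[OF D P V p] natural_connection(2)[OF D P W p])
  qed
  then show ?thesis
    using geometry P affine_natural_connection pseudo_riemannian_deformed_metric
    by (simp add: metric_compatible_geometry_def)
qed

section \<open>Local frames\<close>

lemma differential_cong:
  assumes f: "smooth_function M A U f" and p: "p \<in> U" and eq: "\<And>q. q \<in> U \<Longrightarrow> f q = h q"
  shows "differential A f p v = differential A h p v"
proof -
  \<comment> \<open>The very chart that \<open>differential\<close> picks; the choice depends on
    \<open>p\<close> but not on the function, so both differentials are computed in it.\<close>
  define c where "c = (SOME c. c \<in> A \<and> p \<in> fst c)"
  have U: "openin M U" using f by (simp add: smooth_function_def)
  have c: "c \<in> A" "p \<in> fst c"
    unfolding c_def using someI_ex[of "\<lambda>c. c \<in> A \<and> p \<in> fst c"] chart_cover[OF openin_imp_topspace[OF U p]]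
    by blast+
  let ?S = "snd c ` (U \<inter> fst c)"
  have "Ck_on (Suc 0) (f \<circ> chart_inv c) ?S"
    using f c unfolding smooth_function_def smooth_on_def by blast
  then have "(f \<circ> chart_inv c) differentiable at (snd c p)"
    by (rule differentiableI[OF Ck_on_Suc_has_derivative[OF _ open_chart_image[OF c(1) U]]])
      (use c p in blast)
  then have "frechet_derivative (f \<circ> chart_inv c) (at (snd c p)) = frechet_derivative (h \<circ> chart_inv c) (at (snd c p))"
    by (rule frechet_derivative_transform_within_open[OF _ open_chart_image[OF c(1) U]])
      (use c p eq in auto)
  then show ?thesis
    by (simp add: differential_def c_def[symmetric] Let_def)
qed

lemma local_frameD:
  assumes "local_frame M A U E"
  shows "openin M U" "smooth_field M A U (E i)" "p \<in> U \<Longrightarrow> E i p \<in> tangent_space A p"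
    "p \<in> U \<Longrightarrow> inj (\<lambda>i. E i p)" "p \<in> U \<Longrightarrow> independent (range (\<lambda>i. E i p))"
    "p \<in> U \<Longrightarrow> span (range (\<lambda>i. E i p)) = tangent_space A p"
  using assms smooth_fieldD(2)[of U "E i" p] unfolding local_frame_def by blast+

lemma frame_expansion:
  assumes E: "local_frame M A U E" and p: "p \<in> U" and v: "v \<in> tangent_space A p"
  shows "(\<Sum>i\<in>UNIV. (frame_column E p v $ i) *\<^sub>R E i p) = v"
proof -
  have "(\<Sum>b\<in>range (\<lambda>i. E i p). representation (range (\<lambda>i. E i p)) v b *\<^sub>R b) = v"
    using local_frameD(5,6)[OF E p] v by (intro real_vector.sum_representation_eq) auto
  then show ?thesis
    by (simp add: frame_column_def sum.reindex[OF local_frameD(4)[OF E p]])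
qed

lemma frame_column_sum:
  assumes E: "local_frame M A U E" and p: "p \<in> U" and u: "\<And>i. i \<in> I \<Longrightarrow> u i \<in> tangent_space A p"
  shows "frame_column E p (\<Sum>i\<in>I. r i *\<^sub>R u i) $ k = (\<Sum>i\<in>I. r i * frame_column E p (u i) $ k)"
  using u local_frameD(5,6)[OF E p]
  by (simp add: frame_column_def real_vector.representation_sum real_vector.representation_scale tangent_space_scale)

lemma frame_column_frame:
  assumes E: "local_frame M A U E" and p: "p \<in> U"
  shows "frame_column E p (\<Sum>i\<in>UNIV. z i *\<^sub>R E i p) $ k = z k"
proof -
  have inj: "E i p = E j p \<longleftrightarrow> i = j" for i j
    using inj_eq[OF local_frameD(4)[OF E p]] .
  have column: "frame_column E p (E i p) $ k = (if i = k then 1 else 0)" for i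
    by (auto simp: frame_column_def real_vector.representation_basis[OF local_frameD(5)[OF E p]] inj)
  show ?thesis
    by (simp add: frame_column_sum[OF E p local_frameD(3)[OF E p]] column if_distrib cong: if_cong)
qed

lemma frame_column_add:
  assumes E: "local_frame M A U E" and p: "p \<in> U" and "u \<in> tangent_space A p" "v \<in> tangent_space A p"
  shows "frame_column E p (u + v) = frame_column E p u + frame_column E p v"
  using assms(3,4) local_frameD(5,6)[OF E p]
  by (simp add: frame_column_def vec_eq_iff real_vector.representation_add)

lemma smooth_frame_column:
  assumes E: "local_frame M A U E" and V: "smooth_field M A U V"
  shows "smooth_function M A U (\<lambda>p. frame_column E p (V p) $ i)"
  unfolding smooth_function_def smooth_on_def
proof (intro conjI ballI allI)
  show U: "openin M U" by (rule local_frameD(1)[OF E])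
  fix c k assume c: "c \<in> A"
  let ?S = "snd c ` (U \<inter> fst c)"
  \<comment> \<open>Column \<open>i\<close> is the column of \<open>E i\<close> in the chart
    \<open>c\<close>, so this matrix takes frame components to chart components; independence of the
    frame makes it nonsingular.\<close>
  let ?a = "\<lambda>x. \<chi> k i. component (E i (chart_inv c x)) c $ k"
  note S = open_chart_image[OF c U]
  have "Ck_on k (\<lambda>x. frame_column E (chart_inv c x) (V (chart_inv c x))) ?S"
  proof (rule Ck_on_linear_system[OF S _ smooth_fieldD(3)[OF V c]])
    fix i j
    from iffD1[OF Ck_on_vec[OF S] smooth_fieldD(3)[OF local_frameD(2)[OF E] c], rule_format, of k j i]
    show "Ck_on k (\<lambda>x. ?a x $ i $ j) ?S" by simp
  next
    fix x assume "x \<in> ?S"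
    then obtain p where p: "p \<in> U" "p \<in> fst c" "x = snd c p" by blast
    note Ep = local_frameD(3)[OF E p(1)]
    show "det (?a x) \<noteq> 0"
    proof (rule det_nonzeroI)
      fix z assume "?a x *v z = 0"
      then have "component (\<Sum>i\<in>UNIV. (z $ i) *\<^sub>R E i p) c = component 0 c"
        using p c by (simp add: matrix_of_components)
      then have "(\<Sum>i\<in>UNIV. (z $ i) *\<^sub>R E i p) = 0"
        by (intro tangent_vector_eqI[OF _ tangent_space_0 c p(2)] tangent_space_sum tangent_space_scale Ep)
      then show "z = 0"
        using frame_column_frame[OF E p(1), of "($) z"] frame_column_frame[OF E p(1), of "\<lambda>i. 0"]
        by (simp add: vec_eq_iff)
    qed
    show "?a x *v frame_column E (chart_inv c x) (V (chart_inv c x)) = component (V (chart_inv c x)) c"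
      using p c frame_expansion[OF E p(1) smooth_fieldD(2)[OF V p(1)]] by (simp add: matrix_of_components)
  qed
  from iffD1[OF Ck_on_vec[OF S] this, rule_format, of i]
  show "Ck_on k ((\<lambda>p. frame_column E p (V p) $ i) \<circ> chart_inv c) ?S"
    by (simp add: o_def)
qed

section \<open>Matrices of deformation fields and the transformation of connection
  coefficients\<close>

lemma smooth_field_matrix:
  assumes "deformation_field M A P" "local_frame M A U F" "local_frame M A U E"
  shows "smooth_function M A U (\<lambda>p. field_matrix P F E p $ i $ j)"
  using smooth_frame_column[OF assms(3) deformation_fieldD(3)[OF assms(1) local_frameD(2)[OF assms(2)]]]
  by (simp add: field_matrix_def)

lemma field_matrix_column:
  assumes P: "deformation_field M A P" and F: "local_frame M A U F" and E: "local_frame M A U E"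
    and p: "p \<in> U" and u: "u \<in> tangent_space A p"
  shows "field_matrix P F E p *v frame_column F p u = frame_column E p (P p u)"
proof -
  have top: "p \<in> topspace M" using openin_imp_topspace[OF local_frameD(1)[OF F] p] .
  note Fp = local_frameD(3)[OF F p]
  have "P p u = (\<Sum>j\<in>UNIV. (frame_column F p u $ j) *\<^sub>R P p (F j p))"
    using deformation_field_sum[OF P top, of UNIV "\<lambda>j. F j p" "($) (frame_column F p u)"] Fp
    by (simp add: frame_expansion[OF F p u])
  moreover have "frame_column E p (\<Sum>j\<in>UNIV. (frame_column F p u $ j) *\<^sub>R P p (F j p)) $ i =
      (\<Sum>j\<in>UNIV. frame_column F p u $ j * frame_column E p (P p (F j p)) $ i)" for i
    by (rule frame_column_sum[OF E p deformation_fieldD(2)[OF P top Fp]])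
  ultimately show ?thesis
    by (simp add: vec_eq_iff matrix_vector_mult_def field_matrix_def mult.commute)
qed

lemma field_matrix_compose:
  assumes P: "deformation_field M A P" and Q: "deformation_field M A Q"
    and H: "local_frame M A U H" and F: "local_frame M A U F" and E: "local_frame M A U E" and p: "p \<in> U"
  shows "field_matrix (\<lambda>p. P p \<circ> Q p) H E p = field_matrix P F E p ** field_matrix Q H F p"
proof -
  have "Q p (H j p) \<in> tangent_space A p" for j
    using smooth_fieldD(2)[OF deformation_fieldD(3)[OF Q local_frameD(2)[OF H]] p] .
  from field_matrix_column[OF P F E p this] show ?thesis
    by (simp add: vec_eq_iff matrix_matrix_mult_def matrix_vector_mult_def field_matrix_def)
qed

text \<open>A column in the kernel is the frame column of a vector that \<open>P p\<close> sends to
  zero, so it vanishes by injectivity.\<close>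

lemma invertible_field_matrix:
  assumes P: "deformation_field M A P" and F: "local_frame M A U F" and E: "local_frame M A U E"
    and p: "p \<in> U"
  shows "invertible (field_matrix P F E p)"
  unfolding invertible_det_nz
proof (rule det_nonzeroI)
  fix z assume z: "field_matrix P F E p *v z = 0"
  have top: "p \<in> topspace M" using openin_imp_topspace[OF local_frameD(1)[OF F] p] .
  let ?u = "\<Sum>j\<in>UNIV. (z $ j) *\<^sub>R F j p"
  have u: "?u \<in> tangent_space A p"
    by (intro tangent_space_sum tangent_space_scale local_frameD(3)[OF F p])
  have zu: "frame_column F p ?u = z"
    by (simp add: vec_eq_iff frame_column_frame[OF F p])
  have "frame_column E p (P p ?u) = 0"
    using field_matrix_column[OF P F E p u] z zu by simp
  then have "P p ?u = 0"
    using frame_expansion[OF E p deformation_fieldD(2)[OF P top u]] by simp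
  then have "?u = 0"
    by (rule deformation_field_eq_0[OF P top u])
  then show "z = 0"
    using zu frame_column_frame[OF F p, of "\<lambda>j. 0"] by (simp add: vec_eq_iff)
qed

text \<open>Both sides are the columns, in the frame \<open>E\<close>, of \<open>D (P F\<^sub>j)\<close>: on the left through the natural
  connection, on the right by the Leibniz rule applied to \<open>P F\<^sub>j = \<Sum>\<^sub>l m\<^sub>l\<^sub>j E\<^sub>l\<close>.\<close>

lemma field_matrix_mult_coefficients:
  assumes D: "affine_connection M A D" and P: "deformation_field M A P"
    and F: "local_frame M A U F" and E: "local_frame M A U E"
    and p: "p \<in> U" "v \<in> tangent_space A p"
  defines "m \<equiv> field_matrix P F E"
  shows "m p ** connection_coefficients (natural_connection A P D) F p v =
    connection_coefficients D E p v ** m p + matrix_differential A m p v"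
proof -
  note U = local_frameD(1)[OF F] and F' = local_frameD(2)[OF F] and E' = local_frameD(2)[OF E]
  have "(m p *v frame_column F p (natural_connection A P D p v (F j))) $ i =
      (\<Sum>l\<in>UNIV. frame_column E p (D p v (E l)) $ i * m p $ l $ j)
        + differential A (\<lambda>q. m q $ i $ j) p v" for i j
  proof -
    have m: "smooth_function M A U (\<lambda>q. m q $ l $ j)" for l
      unfolding m_def by (rule smooth_field_matrix[OF P F E])
    note mE = smooth_field_scale[OF m E']
    have PF: "P q (F j q) = (\<Sum>l\<in>UNIV. (m q $ l $ j) *\<^sub>R E l q)" if "q \<in> U" for q
      using frame_expansion[OF E that smooth_fieldD(2)[OF deformation_fieldD(3)[OF P F'] that]]
      by (simp add: m_def field_matrix_def)
    have DE: "D p v (E l) \<in> tangent_space A p" for l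
      by (rule affine_connectionD(2)[OF D E' E' p])
    have "m p *v frame_column F p (natural_connection A P D p v (F j)) =
        frame_column E p (D p v (\<lambda>q. P q (F j q)))"
      using field_matrix_column[OF P F E p(1) natural_connection(1)[OF D P F' p]]
      by (simp add: m_def natural_connection(2)[OF D P F' p])
    also have "D p v (\<lambda>q. P q (F j q)) = D p v (\<lambda>q. \<Sum>l\<in>UNIV. (m q $ l $ j) *\<^sub>R E l q)"
      by (rule affine_connectionD(3)[OF D deformation_fieldD(3)[OF P F'] smooth_field_sum[OF U mE] p PF])
    also have "\<dots> = (\<Sum>l\<in>UNIV. differential A (\<lambda>q. m q $ l $ j) p v *\<^sub>R E l p)
        + (\<Sum>l\<in>UNIV. (m p $ l $ j) *\<^sub>R D p v (E l))"
      by (simp add: affine_connection_sum[OF D mE U p] affine_connectionD(5)[OF D E' E' p m] sum.distrib)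
    also have "frame_column E p \<dots> =
        frame_column E p (\<Sum>l\<in>UNIV. differential A (\<lambda>q. m q $ l $ j) p v *\<^sub>R E l p)
        + frame_column E p (\<Sum>l\<in>UNIV. (m p $ l $ j) *\<^sub>R D p v (E l))"
      by (intro frame_column_add[OF E p(1)] tangent_space_sum tangent_space_scale DE local_frameD(3)[OF E p(1)])
    finally show ?thesis
      by (simp add: frame_column_frame[OF E p(1)] frame_column_sum[OF E p(1) DE] mult.commute)
  qed
  then show ?thesis
    by (simp add: vec_eq_iff matrix_matrix_mult_def matrix_vector_mult_def connection_coefficients_def
        matrix_differential_def)
qed

text \<open>The product identity is multiplied by the inverse matrix from the left. Since
  deformation, reference connection and both frames are free, the two stages and the total
  deformation are three instances.\<close>

lemma natural_connection_coefficients: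
  assumes "affine_connection M A D" "deformation_field M A P" "local_frame M A U F" "local_frame M A U E"
    and "p \<in> U" "v \<in> tangent_space A p"
  shows "connection_coefficients (natural_connection A P D) F p v =
    matrix_inv (field_matrix P F E p) ** connection_coefficients D E p v ** field_matrix P F E p
    + matrix_inv (field_matrix P F E p) ** matrix_differential A (field_matrix P F E) p v"
proof -
  let ?m = "field_matrix P F E p"
  have "matrix_inv ?m ** ?m = mat 1"
    using someI_ex[of "\<lambda>B. ?m ** B = mat 1 \<and> B ** ?m = mat 1"] invertible_field_matrix[OF assms(2-5)]
    by (simp add: matrix_inv_def invertible_def)
  then have "connection_coefficients (natural_connection A P D) F p v =
      matrix_inv ?m ** (?m ** connection_coefficients (natural_connection A P D) F p v)"
    by (simp add: matrix_mul_assoc)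
  then show ?thesis
    by (simp add: field_matrix_mult_coefficients[OF assms] matrix_add_ldistrib matrix_mul_assoc)
qed

end

theorem proposition3p4:
  fixes M :: "'a topology"
    and A :: "('a, 'n::finite) chart set"
    and Adm :: "('a, 'n) bilinear_field \<Rightarrow> ('a, 'n) endo_field set"
    and gbar g1 g2 :: "('a, 'n) bilinear_field"
    and Dbar D1 D2 Dtot :: "('a, 'n) cov_deriv"
    and P1 P2 Ptot :: "('a, 'n) endo_field"
    and U :: "'a set"
    and E F H :: "('a, 'n) frame"
    and m1 m2 :: "'a \<Rightarrow> real^'n^'n"
    and \<Gamma>bar \<Gamma>1 \<Gamma>2 \<Gamma>tot :: "'a \<Rightarrow> ('a, 'n) tvec \<Rightarrow> real^'n^'n"
  assumes reference: "metric_compatible_geometry M A gbar Dbar"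
    and P1: "admissible M A Adm gbar P1"
    and g1: "g1 = deformed_metric P1 gbar"
    and P2: "admissible M A Adm g1 P2"
    and g2: "g2 = deformed_metric P2 g1"
    and D1: "D1 = natural_connection A P1 Dbar"
    and D2: "D2 = natural_connection A P2 D1"
    and Ptot: "Ptot = (\<lambda>p. P1 p \<circ> P2 p)"
    and Dtot: "Dtot = natural_connection A Ptot Dbar"
    and frames: "local_frame M A U E" "local_frame M A U F" "local_frame M A U H"
    and m1: "m1 = field_matrix P1 F E"
    and m2: "m2 = field_matrix P2 H F"
    and \<Gamma>bar: "\<Gamma>bar = connection_coefficients Dbar E"
    and \<Gamma>1: "\<Gamma>1 = connection_coefficients D1 F"
    and \<Gamma>2: "\<Gamma>2 = connection_coefficients D2 H"
    and \<Gamma>tot: "\<Gamma>tot = connection_coefficients Dtot H"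
  shows
    "(\<forall>p\<in>U. \<forall>v\<in>tangent_space A p.
        \<Gamma>1 p v = matrix_inv (m1 p) ** \<Gamma>bar p v ** m1 p
               + matrix_inv (m1 p) ** matrix_differential A m1 p v \<and>
        \<Gamma>2 p v = matrix_inv (m2 p) ** \<Gamma>1 p v ** m2 p
               + matrix_inv (m2 p) ** matrix_differential A m2 p v) \<and>
     deformation_field M A Ptot \<and>
     g2 = deformed_metric Ptot gbar \<and>
     (\<forall>W V. smooth_field M A W V \<longrightarrow>
        (\<forall>p\<in>W. \<forall>v\<in>tangent_space A p. Dtot p v V = D2 p v V)) \<and>
     (\<forall>p\<in>U. field_matrix Ptot H E p = m1 p ** m2 p) \<and>
     (\<forall>p\<in>U. \<forall>v\<in>tangent_space A p.
        \<Gamma>tot p v = matrix_inv (m1 p ** m2 p) ** \<Gamma>bar p v ** (m1 p ** m2 p)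
                 + matrix_inv (m1 p ** m2 p) ** matrix_differential A (\<lambda>q. m1 q ** m2 q) p v \<and>
        \<Gamma>tot p v = matrix_inv (m2 p) ** \<Gamma>1 p v ** m2 p
                 + matrix_inv (m2 p) ** matrix_differential A m2 p v) \<and>
     metric_compatible_geometry M A g1 D1 \<and>
     metric_compatible_geometry M A g2 D2"
proof -
  interpret manifold M A
    using reference by unfold_locales (simp add: metric_compatible_geometry_def)
  have Dbar: "affine_connection M A Dbar"
    using reference by (simp add: metric_compatible_geometry_def)
  have defP1: "deformation_field M A P1" and defP2: "deformation_field M A P2"
    using P1 P2 by (simp_all add: admissible_def)
  have defPtot: "deformation_field M A Ptot"
    unfolding Ptot by (rule deformation_field_compose[OF defP1 defP2])
  have affD1: "affine_connection M A D1"
    unfolding D1 by (rule affine_natural_connection[OF Dbar defP1])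
  have G1: "\<Gamma>1 p v = matrix_inv (m1 p) ** \<Gamma>bar p v ** m1 p
      + matrix_inv (m1 p) ** matrix_differential A m1 p v"
    if "p \<in> U" "v \<in> tangent_space A p" for p v
    unfolding \<Gamma>1 \<Gamma>bar D1 m1
    by (rule natural_connection_coefficients[OF Dbar defP1 frames(2,1) that])
  have G2: "\<Gamma>2 p v = matrix_inv (m2 p) ** \<Gamma>1 p v ** m2 p
      + matrix_inv (m2 p) ** matrix_differential A m2 p v"
    if "p \<in> U" "v \<in> tangent_space A p" for p v
    unfolding \<Gamma>2 \<Gamma>1 D2 m2
    by (rule natural_connection_coefficients[OF affD1 defP2 frames(3,2) that])
  have Dtot2: "Dtot p v V = D2 p v V" if "smooth_field M A W V" "p \<in> W" "v \<in> tangent_space A p" for W V p v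
    unfolding Dtot Ptot D2 D1 by (rule natural_connection_compose[OF Dbar defP1 defP2 that])
  have mtot: "field_matrix Ptot H E p = m1 p ** m2 p" if "p \<in> U" for p
    unfolding Ptot m1 m2 by (rule field_matrix_compose[OF defP1 defP2 frames(3,2,1) that])
  have Gtot: "\<Gamma>tot p v = matrix_inv (m1 p ** m2 p) ** \<Gamma>bar p v ** (m1 p ** m2 p)
      + matrix_inv (m1 p ** m2 p) ** matrix_differential A (\<lambda>q. m1 q ** m2 q) p v"
    if p: "p \<in> U" "v \<in> tangent_space A p" for p v
  proof -
    \<comment> \<open>The matrix of the composite is known to be the product on \<open>U\<close>
      only, which suffices because a differential at \<open>p\<close> depends on values near
      \<open>p\<close>.\<close>
    have "matrix_differential A (field_matrix Ptot H E) p v = matrix_differential A (\<lambda>q. m1 q ** m2 q) p v"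
      unfolding matrix_differential_def vec_eq_iff vec_lambda_beta
      by (intro allI differential_cong[OF smooth_field_matrix[OF defPtot frames(3,1)] p(1)])
        (simp add: mtot)
    then show ?thesis
      using natural_connection_coefficients[OF Dbar defPtot frames(3,1) p]
      by (simp add: \<Gamma>tot \<Gamma>bar Dtot mtot[OF p(1)])
  qed
  have Gtot2: "\<Gamma>tot p v = matrix_inv (m2 p) ** \<Gamma>1 p v ** m2 p
      + matrix_inv (m2 p) ** matrix_differential A m2 p v"
    if p: "p \<in> U" "v \<in> tangent_space A p" for p v
  proof -
    \<comment> \<open>\<open>Dtot\<close> and \<open>D2\<close> are compared on smooth local fields
      only; the coefficients evaluate them on the frame \<open>H\<close>, which consists of such
      fields.\<close>
    have "\<Gamma>tot p v = \<Gamma>2 p v"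
      unfolding \<Gamma>tot \<Gamma>2 connection_coefficients_def Dtot2[OF local_frameD(2)[OF frames(3)] p] ..
    then show ?thesis using G2[OF p] by simp
  qed
  have geometry1: "metric_compatible_geometry M A g1 D1"
    unfolding g1 D1 by (rule deformed_geometry[OF reference defP1])
  have geometry2: "metric_compatible_geometry M A g2 D2"
    unfolding g2 D2 by (rule deformed_geometry[OF geometry1 defP2])
  have g2tot: "g2 = deformed_metric Ptot gbar"
    by (simp add: g2 g1 Ptot deformed_metric_def)
  show ?thesis
    by (intro conjI ballI allI impI)
      (fact G1 G2 defPtot g2tot Dtot2 mtot Gtot Gtot2 geometry1 geometry2)+
qed

end
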